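(* Let $0\le m\le n$ be integers and fix a monomial order $<$ on $\mathbb{C}\big[\mathbf{x}_{\binom{[n]}{2}}\big]$. For any nonempty $B\subseteq[n]$, let $T_B$ be the tree with vertex set $B$ such that $$\mathfrak{m}(T_B)=\min\{\mathfrak{m}(T): T\text{ is a tree with vertex set }B\},$$ the minimum being taken with respect to $<$. Then the family of monomials $$\Big\{\prod_{B\in\pi}\mathfrak{m}(T_B):\pi\in\Pi_{n,m}\Big\}$$ descends to the standard monomial basis, with respect to $<$, of $R(\Pi_{n,m})=\mathbb{C}\big[\mathbf{x}_{\binom{[n]}{2}}\big]/I_{n,m}$.
   Context: Let $[n]=\{1,\dots,n\}$ and let $\binom{[n]}{2}$ be the set of 2-element subsets of $[n]$. Let $\mathbb{C}\big[\mathbf{x}_{\binom{[n]}{2}}\big]$ be the polynomial ring in the variables $x_{\{i,j\}}=x_{\{j,i\}}$ indexed by $\binom{[n]}{2}$; it is the coordinate ring of $\mathbb{C}^{\binom{[n]}{2}}$. An unordered set partition $\pi$ of $[n]$ is identified with the point $\mathbf{z}\in\mathbb{C}^{\binom{[n]}{2}}$ with $z_{\{i,j\}}=1$ if $i,j$ lie in the same block of $\pi$, and $z_{\{i,j\}}=0$ otherwise. $\Pi_{n,m}\subseteq\mathbb{C}^{\binom{[n]}{2}}$ is the finite set of (points identified with) unordered set partitions of $[n]$ all of whose blocks have size at most $m$. For a finite set $\mathcal{Z}\subseteq\mathbb{C}^{\binom{[n]}{2}}$, $\mathbf{I}(\mathcal{Z})$ is the ideal of polynomials vanishing on $\mathcal{Z}$;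 for a nonzero polynomial $f$, $\tau(f)$ is its top-degree homogeneous component; $\mathrm{gr}\,\mathbf{I}(\mathcal{Z})=\langle\tau(f): 0\ne f\in\mathbf{I}(\mathcal{Z})\rangle$; and $R(\mathcal{Z})=\mathbb{C}\big[\mathbf{x}_{\binom{[n]}{2}}\big]/\mathrm{gr}\,\mathbf{I}(\mathcal{Z})$. For a simple graph $G$ with vertices in $[n]$ and edge set $E(G)\subseteq\binom{[n]}{2}$, the graph monomial is $\mathfrak{m}(G)=\prod_{S\in E(G)}x_S$. The ideal $I_{n,m}\subseteq\mathbb{C}\big[\mathbf{x}_{\binom{[n]}{2}}\big]$ is generated by all squares $x_S^2$ for $S\in\binom{[n]}{2}$; all differences $x_{\{i,j\}}x_{\{j,k\}}-x_{\{i,k\}}x_{\{j,k\}}$ for pairwise distinct $i,j,k\in[n]$; and all monomials $\mathfrak{m}(T)$ for trees $T$ with $m+1$ vertices in $[n]$. A monomial order is a total order on monomials with $1\le u$ for every monomial $u$, and $u_1<u_2\Rightarrow uu_1<uu_2$. The standard monomial basis of $\mathbb{C}\big[\mathbf{x}_{\binom{[n]}{2}}\big]/I$ consists of the images of all monomials not in the initial ideal $\mathrm{in}_<I=\langle\mathrm{in}_<f:0\neq f\in I\rangle$, where $\mathrm{in}_<f$ is the largest monomial occurring in $f$. *)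

theory Defs
  imports
    Complex_Main
    "HOL-Library.Poly_Mapping"
    "HOL-Library.Disjoint_Sets"
    "HOL-Library.FuncSet"
    "HOL-Algebra.QuotRing"
begin

definition pairs :: "nat \<Rightarrow> nat set set" where
  "pairs n = {S. S \<subseteq> {1..n} \<and> card S = 2}"

text \<open>
  A monomial is represented by its exponent vector, so that the product of monomials is the
  sum of exponent vectors and the monomial 1 is the exponent vector 0.
\<close>

type_synonym expo = "nat set \<Rightarrow>\<^sub>0 nat"
type_synonym mpoly = "expo \<Rightarrow>\<^sub>0 complex"

definition monomials :: "nat \<Rightarrow> expo set" where
  "monomials n = {t. Poly_Mapping.keys t \<subseteq> pairs n}"

definition poly_ring :: "nat \<Rightarrow> mpoly ring" where
  "poly_ring n =
     \<lparr>carrier = {f. Poly_Mapping.keys f \<subseteq> monomials n}, mult = (*), one = 1, zero = 0, add = (+)\<rparr>"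

definition Monomial :: "expo \<Rightarrow> mpoly" where
  "Monomial t = Poly_Mapping.single t 1"

definition Var :: "nat set \<Rightarrow> mpoly" where
  "Var S = Monomial (Poly_Mapping.single S 1)"

definition Const :: "complex \<Rightarrow> mpoly" where
  "Const c = Poly_Mapping.single 0 c"

definition poly_eval :: "(nat set \<Rightarrow> complex) \<Rightarrow> mpoly \<Rightarrow> complex" where
  "poly_eval z f =
     (\<Sum>t\<in>Poly_Mapping.keys f. Poly_Mapping.lookup f t * (\<Prod>S\<in>Poly_Mapping.keys t. z S ^ Poly_Mapping.lookup t S))"

definition expo_deg :: "expo \<Rightarrow> nat" where
  "expo_deg t = (\<Sum>S\<in>Poly_Mapping.keys t. Poly_Mapping.lookup t S)"

definition top_component :: "mpoly \<Rightarrow> mpoly" where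
  "top_component f =
     (\<Sum>t\<in>{t \<in> Poly_Mapping.keys f. expo_deg t = Max (expo_deg ` Poly_Mapping.keys f)}.
        Poly_Mapping.single t (Poly_Mapping.lookup f t))"

lemma poly_ring_cring: "cring (poly_ring n)"
proof -
  have add: "Poly_Mapping.keys (a + b) \<subseteq> monomials n"
    if "Poly_Mapping.keys a \<subseteq> monomials n" "Poly_Mapping.keys b \<subseteq> monomials n" for a b :: mpoly
    using that Poly_Mapping.keys_add[of a b] by blast
  have mult: "Poly_Mapping.keys (a * b) \<subseteq> monomials n"
    if a: "Poly_Mapping.keys a \<subseteq> monomials n" and b: "Poly_Mapping.keys b \<subseteq> monomials n" for a b :: mpoly
  proof
    fix t assume "t \<in> Poly_Mapping.keys (a * b)"
    then obtain u v where "t = u + v" "u \<in> Poly_Mapping.keys a" "v \<in> Poly_Mapping.keys b"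
      using Poly_Mapping.keys_mult[of a b] by blast
    moreover from this a b have "Poly_Mapping.keys u \<subseteq> pairs n" "Poly_Mapping.keys v \<subseteq> pairs n"
      by (auto simp: monomials_def)
    ultimately show "t \<in> monomials n"
      using Poly_Mapping.keys_add[of u v] by (auto simp: monomials_def)
  qed
  have neg: "\<exists>b. Poly_Mapping.keys b \<subseteq> monomials n \<and> a + b = 0"
    if "Poly_Mapping.keys a \<subseteq> monomials n" for a :: mpoly
    using that by (intro exI[of _ "- a"]) simp
  have one: "0 \<in> monomials n"
    by (simp add: monomials_def)
  show ?thesis
  proof (intro cringI abelian_groupI comm_monoidI)
  qed (use neg in \<open>auto simp: poly_ring_def algebra_simps one dest: subsetD[OF add] subsetD[OF mult]\<close>)
qed

definition partitions :: "nat \<Rightarrow> nat \<Rightarrow> nat set set set" where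
  "partitions n m = {\<pi>. partition_on {1..n} \<pi> \<and> (\<forall>B\<in>\<pi>. card B \<le> m)}"

text \<open>A point of the affine space is a function that is \<^const>\<open>undefined\<close> outside \<^term>\<open>pairs n\<close>.\<close>

definition partition_point :: "nat \<Rightarrow> nat set set \<Rightarrow> nat set \<Rightarrow> complex" where
  "partition_point n \<pi> = (\<lambda>S\<in>pairs n. if \<exists>B\<in>\<pi>. S \<subseteq> B then 1 else 0)"

definition partition_points :: "nat \<Rightarrow> nat \<Rightarrow> (nat set \<Rightarrow> complex) set" where
  "partition_points n m = partition_point n ` partitions n m"

definition vanishing_ideal :: "nat \<Rightarrow> (nat set \<Rightarrow> complex) set \<Rightarrow> mpoly set" where
  "vanishing_ideal n Z = {f \<in> carrier (poly_ring n). \<forall>z\<in>Z. poly_eval z f = 0}"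

definition gr_ideal :: "nat \<Rightarrow> (nat set \<Rightarrow> complex) set \<Rightarrow> mpoly set" where
  "gr_ideal n Z =
     Idl\<^bsub>poly_ring n\<^esub> {top_component f |f. f \<in> vanishing_ideal n Z \<and> f \<noteq> 0}"

definition orbit_harmonics_ring :: "nat \<Rightarrow> (nat set \<Rightarrow> complex) set \<Rightarrow> mpoly set ring" where
  "orbit_harmonics_ring n Z = poly_ring n Quot gr_ideal n Z"

text \<open>A simple graph is given by a vertex set \<open>V\<close> and a set \<open>E\<close> of 2-subsets of \<open>V\<close>.\<close>

definition is_tree :: "'a set \<Rightarrow> 'a set set \<Rightarrow> bool" where
  "is_tree V E \<longleftrightarrow>
     finite V \<and> V \<noteq> {} \<and> (\<forall>e\<in>E. e \<subseteq> V \<and> card e = 2) \<and>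
     (\<forall>u\<in>V. \<forall>v\<in>V. (u, v) \<in> {(x, y). {x, y} \<in> E}\<^sup>*) \<and>
     \<not> (\<exists>c. length c \<ge> 3 \<and> distinct c \<and>
          (\<forall>i<length c. {c ! i, c ! ((i + 1) mod length c)} \<in> E))"

definition graph_monomial :: "nat set set \<Rightarrow> expo" where
  "graph_monomial E = (\<Sum>S\<in>E. Poly_Mapping.single S 1)"

definition tree_ideal :: "nat \<Rightarrow> nat \<Rightarrow> mpoly set" where
  "tree_ideal n m = Idl\<^bsub>poly_ring n\<^esub>
     ({Var S ^ 2 |S. S \<in> pairs n} \<union>
      {Var {i, j} * Var {j, k} - Var {i, k} * Var {j, k} |i j k.
         {i, j, k} \<subseteq> {1..n} \<and> i \<noteq> j \<and> j \<noteq> k \<and> i \<noteq> k} \<union>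
      {Monomial (graph_monomial E) |V E. V \<subseteq> {1..n} \<and> card V = m + 1 \<and> is_tree V E})"

text \<open>A monomial order is given as a reflexive relation: \<open>(u, v) \<in> r\<close> means \<open>u \<le> v\<close>.\<close>

definition monomial_order :: "nat \<Rightarrow> expo rel \<Rightarrow> bool" where
  "monomial_order n r \<longleftrightarrow>
     linear_order_on (monomials n) r \<and>
     (\<forall>u\<in>monomials n. (0, u) \<in> r) \<and>
     (\<forall>u\<in>monomials n. \<forall>u1\<in>monomials n. \<forall>u2\<in>monomials n.
        (u1, u2) \<in> r \<and> u1 \<noteq> u2 \<longrightarrow> (u + u1, u + u2) \<in> r \<and> u + u1 \<noteq> u + u2)"

definition initial_monomial :: "expo rel \<Rightarrow> mpoly \<Rightarrow> expo" where
  "initial_monomial r f = (THE t. t \<in> Poly_Mapping.keys f \<and> (\<forall>s\<in>Poly_Mapping.keys f. (s, t) \<in> r))"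

definition initial_ideal :: "nat \<Rightarrow> expo rel \<Rightarrow> mpoly set \<Rightarrow> mpoly set" where
  "initial_ideal n r I =
     Idl\<^bsub>poly_ring n\<^esub> {Monomial (initial_monomial r f) |f. f \<in> I \<and> f \<noteq> 0}"

definition standard_monomials :: "nat \<Rightarrow> expo rel \<Rightarrow> mpoly set \<Rightarrow> expo set" where
  "standard_monomials n r I = {t \<in> monomials n. Monomial t \<notin> initial_ideal n r I}"

definition standard_monomial_basis :: "nat \<Rightarrow> expo rel \<Rightarrow> mpoly set \<Rightarrow> mpoly set set" where
  "standard_monomial_basis n r I =
     (\<lambda>t. I +>\<^bsub>poly_ring n\<^esub> Monomial t) ` standard_monomials n r I"

text \<open>
  The finite family \<open>(b p)\<close>, \<open>p \<in> P\<close>, of polynomials descends to a basis of the quotient by \<open>I\<close>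
  as a complex vector space; taking \<open>c\<close> extensional makes coefficient families on \<open>P\<close> unique.
\<close>

definition descends_to_basis :: "nat \<Rightarrow> mpoly set \<Rightarrow> 'a set \<Rightarrow> ('a \<Rightarrow> mpoly) \<Rightarrow> bool" where
  "descends_to_basis n I P b \<longleftrightarrow>
     finite P \<and> b ` P \<subseteq> carrier (poly_ring n) \<and>
     (\<forall>f\<in>carrier (poly_ring n). \<exists>!c. c \<in> P \<rightarrow>\<^sub>E (UNIV :: complex set) \<and>
        I +>\<^bsub>poly_ring n\<^esub> f = I +>\<^bsub>poly_ring n\<^esub> (\<Sum>p\<in>P. Const (c p) * b p))"

definition min_tree :: "expo rel \<Rightarrow> nat set \<Rightarrow> nat set set" where
  "min_tree r B =
     (THE E. is_tree B E \<and>
        (\<forall>E'. is_tree B E' \<longrightarrow> (graph_monomial E, graph_monomial E') \<in> r))"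

definition partition_monomial :: "expo rel \<Rightarrow> nat set set \<Rightarrow> expo" where
  "partition_monomial r \<pi> = (\<Sum>B\<in>\<pi>. graph_monomial (min_tree r B))"

end

theory Submission
  imports Defs
begin

text \<open>
  A monomial is read as the graph of the variables dividing it, and sent to the partition of
  \<open>[n]\<close> into the connected components of that graph. A graph with \<open>k\<close> components has at
  least \<open>n - k\<close> edges, with equality exactly for forests, so a monomial of degree \<open>d\<close> with
  \<open>k\<close> components satisfies \<open>n \<le> k + d\<close>, with equality exactly if it is square-free and its
  graph is a forest.

  Modulo the tree ideal every monomial depends on very little. The relations
  \<open>x\<^sub>i\<^sub>jx\<^sub>j\<^sub>k = x\<^sub>i\<^sub>kx\<^sub>j\<^sub>k\<close> turn each tree of a forest into a star, a variable within a component of a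
  forest then produces a square, and a component with more than \<open>m\<close> vertices contains a tree
  with \<open>m + 1\<close> vertices. Hence a monomial is zero unless it is a forest whose components form
  a partition in \<open>\<Pi>\<^sub>n\<^sub>,\<^sub>m\<close>, and two forests with the same components agree
  (\<open>tree_ideal_or_cong_block_stars\<close>, \<open>Monomial_in_tree_ideal\<close>). Conversely, for each
  partition \<open>\<pi>\<close> in \<open>\<Pi>\<^sub>n\<^sub>,\<^sub>m\<close> the functional that sums the coefficients of all forests with
  components \<open>\<pi>\<close> vanishes on the tree ideal. So the tree ideal is exactly the common kernel
  of these functionals (\<open>tree_ideal_eq_kernel\<close>), and any choice of one forest for every
  partition descends to a basis of the quotient, the functionals being the coordinates.

  The same functionals identify the tree ideal with \<open>gr I(\<Pi>\<^sub>n\<^sub>,\<^sub>m)\<close>. The generators of the tree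
  ideal are top components of polynomials that vanish on the partition points. For the other
  inclusion, the value of a monomial with components \<open>\<rho>\<close> at the point of \<open>\<sigma>\<close> is 1 if
  \<open>\<rho>\<close> refines \<open>\<sigma>\<close> and 0 otherwise. The incidence matrix of refinement is unitriangular, so if
  \<open>f\<close> vanishes on all points, then for every \<open>\<pi>\<close> in \<open>\<Pi>\<^sub>n\<^sub>,\<^sub>m\<close> the coefficients of
  all monomials of \<open>f\<close> with components \<open>\<pi>\<close> add up to 0 (\<open>vanishing_component_sum\<close>). Forests are
  the monomials of least degree for their components; hence if they occur in the top degree of
  \<open>f\<close>, then they are all that contributes to that sum, and every functional vanishes on the top
  component of \<open>f\<close>.

  For the standard monomials, fix \<open>\<pi>\<close>. A forest with components \<open>\<pi>\<close> is a product of spanning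
  trees of the blocks, so the product of the minimal trees is the least of them. All the others
  are initial monomials of differences of two forests, whereas the least one is not the initial
  monomial of any \<open>f\<close> in the ideal: no other forest with components \<open>\<pi>\<close> could occur in \<open>f\<close>, and
  the functional of \<open>\<pi>\<close> would pick out its coefficient.
\<close>


section \<open>Connected components and cycles\<close>

definition conn :: "'a set set \<Rightarrow> 'a rel" where
  "conn E = {(x, y). {x, y} \<in> E}\<^sup>*"

text \<open>The relation \<^term>\<open>conn E\<close> is reflexive on the whole type, so the vertices whose classes
  count as components are given separately.\<close>

definition comps :: "'a set \<Rightarrow> 'a set set \<Rightarrow> 'a set set" where
  "comps V E = (\<lambda>x. conn E `` {x}) ` V"

definition graph_on :: "'a set \<Rightarrow> 'a set set \<Rightarrow> bool" where
  "graph_on V E \<longleftrightarrow> (\<forall>e\<in>E. e \<subseteq> V \<and> card e = 2)"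

definition has_cycle :: "'a set set \<Rightarrow> bool" where
  "has_cycle E \<longleftrightarrow> (\<exists>c. length c \<ge> 3 \<and> distinct c \<and>
     (\<forall>i<length c. {c ! i, c ! ((i + 1) mod length c)} \<in> E))"

lemma is_tree_iff:
  "is_tree V E \<longleftrightarrow> finite V \<and> V \<noteq> {} \<and> graph_on V E \<and> V \<times> V \<subseteq> conn E \<and> \<not> has_cycle E"
  by (auto simp: is_tree_def graph_on_def conn_def has_cycle_def)

lemma conn_refl [simp]: "(x, x) \<in> conn E"
  by (simp add: conn_def)

lemma conn_sym: "(x, y) \<in> conn E \<Longrightarrow> (y, x) \<in> conn E"
proof -
  have "sym (conn E)"
    unfolding conn_def by (rule sym_rtrancl) (auto simp: sym_def insert_commute)
  then show "(x, y) \<in> conn E \<Longrightarrow> (y, x) \<in> conn E" by (rule symD)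
qed

lemma conn_trans: "(x, y) \<in> conn E \<Longrightarrow> (y, z) \<in> conn E \<Longrightarrow> (x, z) \<in> conn E"
  unfolding conn_def by (rule rtrancl_trans)

lemma conn_edge: "{x, y} \<in> E \<Longrightarrow> (x, y) \<in> conn E"
  by (auto simp: conn_def)

lemma conn_mono: "E \<subseteq> F \<Longrightarrow> conn E \<subseteq> conn F"
  unfolding conn_def by (rule rtrancl_mono) auto

lemma conn_class_eq: "conn E `` {x} = conn E `` {y} \<longleftrightarrow> (x, y) \<in> conn E"
  by (auto intro: conn_sym conn_trans)

lemma conn_least:
  assumes "equiv UNIV r" "\<And>x y. {x, y} \<in> E \<Longrightarrow> (x, y) \<in> r"
  shows "conn E \<subseteq> r"
proof
  fix p assume "p \<in> conn E"
  then obtain x y where p: "p = (x, y)" "(x, y) \<in> {(x, y). {x, y} \<in> E}\<^sup>*"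
    by (cases p) (auto simp: conn_def)
  from p(2) have "(x, y) \<in> r"
    by induction (use assms in \<open>auto simp: equiv_def refl_on_def dest: transD\<close>)
  then show "p \<in> r" by (simp add: p)
qed

lemma graph_on_subset: "graph_on V E \<Longrightarrow> F \<subseteq> E \<Longrightarrow> graph_on V F"
  by (auto simp: graph_on_def)

lemma graph_on_finite: "finite V \<Longrightarrow> graph_on V E \<Longrightarrow> finite E"
  by (rule finite_subset[of _ "Pow V"]) (auto simp: graph_on_def)

lemma graph_on_insert:
  "graph_on V (insert {x, y} E) \<longleftrightarrow> x \<in> V \<and> y \<in> V \<and> x \<noteq> y \<and> graph_on V E"
  by (auto simp: graph_on_def card_2_iff doubleton_eq_iff)

lemma graph_on_edge:
  assumes "graph_on V E" "e \<in> E"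
  obtains x y where "e = {x, y}" "x \<in> V" "y \<in> V" "x \<noteq> y"
  using assms by (fastforce simp: graph_on_def card_2_iff)

lemma conn_within:
  assumes "graph_on V E" "(x, y) \<in> conn E" "x \<in> V"
  shows "y \<in> V"
  using assms(2,3) unfolding conn_def
  by induction (use assms(1) in \<open>auto simp: graph_on_def\<close>)

lemma partition_on_comps:
  assumes "graph_on V E"
  shows "partition_on V (comps V E)"
proof (rule partition_onI)
  show "\<Union> (comps V E) = V"
    using conn_within[OF assms] by (auto simp: comps_def)
  have "x \<in> conn E `` {x}" for x by simp
  then show "{} \<notin> comps V E"
    unfolding comps_def by blast
  fix p q assume "p \<in> comps V E" "q \<in> comps V E" "p \<noteq> q"
  then show "disjnt p q"
    unfolding comps_def disjnt_iff by (auto simp: conn_class_eq) (meson conn_sym conn_trans)+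
qed

lemma finite_comps: "finite V \<Longrightarrow> finite (comps V E)"
  by (simp add: comps_def)

lemma partition_on_same_block:
  assumes "partition_on V \<pi>" "B \<in> \<pi>" "C \<in> \<pi>" "x \<in> B" "x \<in> C"
  shows "B = C"
  using assms by (auto simp: partition_on_def disjoint_def)

lemma comps_subset_block:
  assumes "partition_on V \<pi>" "\<And>e. e \<in> E \<Longrightarrow> \<exists>B\<in>\<pi>. e \<subseteq> B" "C \<in> comps V E"
  shows "\<exists>B\<in>\<pi>. C \<subseteq> B"
proof -
  obtain x where x: "x \<in> V" "C = conn E `` {x}" using assms(3) by (auto simp: comps_def)
  then obtain B where B: "B \<in> \<pi>" "x \<in> B" using assms(1) by (auto simp: partition_on_def)
  have "y \<in> B" if "(x, y) \<in> conn E" for y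
    using that unfolding conn_def
  proof induction
    case (step y z)
    then obtain B' where B': "B' \<in> \<pi>" "{y, z} \<subseteq> B'" using assms(2) by blast
    with step B partition_on_same_block[OF assms(1), of B B' y] show ?case by auto
  qed (use B in auto)
  then show ?thesis using B x by auto
qed

lemma edge_in_comp:
  assumes "graph_on V E" "e \<in> E"
  shows "\<exists>B\<in>comps V E. e \<subseteq> B"
proof -
  obtain x y where xy: "e = {x, y}" "x \<in> V" "y \<in> V" using assms by (meson graph_on_edge)
  then have "(x, y) \<in> conn E" using assms by (auto intro: conn_edge)
  then show ?thesis using xy by (intro bexI[of _ "conn E `` {x}"]) (auto simp: comps_def)
qed

text \<open>Two partitions of the same set agree as soon as each block of either one lies in a block
  of the other.\<close>

lemma comps_eqI:
  assumes "graph_on V E" "partition_on V \<pi>"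
    and "\<And>e. e \<in> E \<Longrightarrow> \<exists>B\<in>\<pi>. e \<subseteq> B"
    and "\<And>B. B \<in> \<pi> \<Longrightarrow> B \<times> B \<subseteq> conn E"
  shows "comps V E = \<pi>"
proof (rule refines_asym)
  show "refines V (comps V E) \<pi>"
    using partition_on_comps[OF assms(1)] comps_subset_block[OF assms(2,3)] assms(2)
    by (auto simp: refines_def)
  have "\<exists>C\<in>comps V E. B \<subseteq> C" if B: "B \<in> \<pi>" for B
  proof -
    obtain x where "x \<in> B" "x \<in> V" using B partition_onD1[OF assms(2)] partition_onD3[OF assms(2)] by (cases "B = {}") auto
    moreover have "B \<subseteq> conn E `` {x}" using assms(4)[OF B] \<open>x \<in> B\<close> by auto
    ultimately show ?thesis by (auto simp: comps_def)
  qed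
  then show "refines V \<pi> (comps V E)"
    using partition_on_comps[OF assms(1)] assms(2) by (auto simp: refines_def)
qed

lemma conn_insert:
  "conn (insert {a, b} E) = conn E \<union>
     (conn E `` {a} \<union> conn E `` {b}) \<times> (conn E `` {a} \<union> conn E `` {b})" (is "_ = ?R")
proof
  define S where "S = conn E `` {a} \<union> conn E `` {b}"
  have closed: "y \<in> S \<longleftrightarrow> x \<in> S" if "(x, y) \<in> conn E" for x y
    using that conn_sym[OF that] unfolding S_def by (auto intro: conn_trans)
  have "refl ?R" by (auto simp: refl_on_def)
  moreover have "sym ?R" by (auto simp: sym_def intro: conn_sym)
  moreover have "trans ?R"
    unfolding S_def[symmetric] by (rule transI) (use closed in \<open>auto intro: conn_trans\<close>)
  ultimately have "equiv UNIV ?R" by (auto simp: equiv_def)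
  then show "conn (insert {a, b} E) \<subseteq> ?R"
  proof (rule conn_least)
    fix x y assume "{x, y} \<in> insert {a, b} E"
    then have "x = a \<and> y = b \<or> x = b \<and> y = a \<or> (x, y) \<in> conn E"
      by (auto simp: doubleton_eq_iff conn_edge)
    then show "(x, y) \<in> ?R" by (elim disjE) simp_all
  qed
  have sub: "conn E \<subseteq> conn (insert {a, b} E)" by (rule conn_mono) auto
  have "(a, b) \<in> conn (insert {a, b} E)" by (rule conn_edge) simp
  then have "(a, x) \<in> conn (insert {a, b} E)" if "x \<in> S" for x
    using that sub by (auto simp: S_def intro: conn_trans)
  then show "?R \<subseteq> conn (insert {a, b} E)"
    using sub unfolding S_def[symmetric] by (auto intro: conn_trans[OF conn_sym])
qed

lemma conn_insert_redundant: "(a, b) \<in> conn E \<Longrightarrow> conn (insert {a, b} E) = conn E"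
  using conn_class_eq[of E a b] unfolding conn_insert
  by (auto intro: conn_trans[OF conn_sym])

lemma comps_insert_redundant: "(a, b) \<in> conn E \<Longrightarrow> comps V (insert {a, b} E) = comps V E"
  by (simp add: comps_def conn_insert_redundant)

lemma comps_insert_merge:
  assumes "graph_on V (insert {a, b} E)"
  defines "A \<equiv> conn E `` {a}" and "B \<equiv> conn E `` {b}"
  shows "comps V (insert {a, b} E) = insert (A \<union> B) (comps V E - {A, B})"
proof (rule comps_eqI[OF assms(1)])
  have ab: "a \<in> V" "b \<in> V" and g: "graph_on V E"
    using assms(1) by (auto simp: graph_on_insert)
  have AB: "A \<in> comps V E" "B \<in> comps V E"
    using ab by (auto simp: A_def B_def comps_def)
  have part: "partition_on V (comps V E)" by (rule partition_on_comps[OF g])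
  show "partition_on V (insert (A \<union> B) (comps V E - {A, B}))"
  proof (rule partition_onI)
    show "\<Union> (insert (A \<union> B) (comps V E - {A, B})) = V"
      using partition_onD1[OF part] AB by auto
    show "{} \<notin> insert (A \<union> B) (comps V E - {A, B})"
      using partition_onD3[OF part] AB by auto
    have dis: "disjnt p q" if "p \<in> comps V E" "q \<in> comps V E" "p \<noteq> q" for p q
      using partition_onD2[OF part] that by (auto simp: disjoint_def disjnt_def)
    fix p q assume "p \<in> insert (A \<union> B) (comps V E - {A, B})"
      "q \<in> insert (A \<union> B) (comps V E - {A, B})" "p \<noteq> q"
    then consider "p = A \<union> B" "q \<in> comps V E" "A \<noteq> q" "B \<noteq> q"
      | "q = A \<union> B" "p \<in> comps V E" "p \<noteq> A" "p \<noteq> B" | "p \<in> comps V E" "q \<in> comps V E"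
      by auto
    then show "disjnt p q"
      by cases (use AB \<open>p \<noteq> q\<close> in \<open>simp_all add: dis disjnt_Un1 disjnt_Un2\<close>)
  qed
  show "\<exists>C\<in>insert (A \<union> B) (comps V E - {A, B}). e \<subseteq> C" if e: "e \<in> insert {a, b} E" for e
  proof (cases "e = {a, b}")
    case True
    then show ?thesis by (intro bexI[of _ "A \<union> B"]) (auto simp: A_def B_def)
  next
    case False
    then obtain C where C: "C \<in> comps V E" "e \<subseteq> C" using edge_in_comp[OF g, of e] e by auto
    show ?thesis
    proof (cases "C \<in> {A, B}")
      case True
      then have "e \<subseteq> A \<union> B" using C(2) by auto
      then show ?thesis by simp
    next
      case False
      then have "C \<in> insert (A \<union> B) (comps V E - {A, B})" using C(1) by simp
      then show ?thesis using C(2) by (rule bexI[rotated])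
    qed
  qed
  show "C \<times> C \<subseteq> conn (insert {a, b} E)" if "C \<in> insert (A \<union> B) (comps V E - {A, B})" for C
  proof (cases "C = A \<union> B")
    case False
    then have "C \<in> comps V E" using that by blast
    then obtain x where "C = conn E `` {x}" unfolding comps_def by blast
    then have "C \<times> C \<subseteq> conn E" by (auto simp del: conn_refl) (rule conn_trans[OF conn_sym])
    then show ?thesis unfolding conn_insert by blast
  qed (auto simp: conn_insert A_def B_def)
qed

lemma card_comps_insert_merge:
  assumes "finite V" "graph_on V (insert {a, b} E)" "(a, b) \<notin> conn E"
  shows "Suc (card (comps V (insert {a, b} E))) = card (comps V E)"
proof -
  define A B where "A = conn E `` {a}" and "B = conn E `` {b}"
  have ab: "a \<in> V" "b \<in> V" and g: "graph_on V E"
    using assms(2) by (auto simp: graph_on_insert)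
  have AB: "A \<in> comps V E" "B \<in> comps V E" "A \<noteq> B"
    using ab assms(3) conn_class_eq[of E a b] by (auto simp: A_def B_def comps_def)
  have "A \<union> B \<notin> comps V E - {A, B}"
    using AB partition_on_comps[OF g] partition_on_same_block[of V "comps V E" "A \<union> B" A a]
    by (auto simp: A_def)
  moreover have "comps V (insert {a, b} E) = insert (A \<union> B) (comps V E - {A, B})"
    using comps_insert_merge[OF assms(2)] by (simp add: A_def B_def)
  moreover have "card {A, B} \<le> card (comps V E)"
    using AB by (intro card_mono finite_comps assms(1)) auto
  ultimately show ?thesis
    using AB finite_comps[OF assms(1), of E] by (simp add: card_Diff_subset)
qed

lemma comps_empty: "comps V {} = (\<lambda>x. {x}) ` V"
  by (auto simp: comps_def conn_def)

text \<open>The edgeless graph has \<^term>\<open>card V\<close> components, and each new edge merges at most two of them.\<close>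

lemma card_le_comps_plus_edges:
  assumes "finite V" "graph_on V E"
  shows "card V \<le> card (comps V E) + card E"
proof -
  have "finite E" using assms by (rule graph_on_finite)
  then show ?thesis using assms(2)
  proof (induction E)
    case empty
    show ?case by (simp add: comps_empty card_image)
  next
    case (insert e E)
    obtain a b where e: "e = {a, b}" using graph_on_edge[OF insert.prems, of e] by blast
    have IH: "card V \<le> card (comps V E) + card E"
      using insert.IH insert.prems by (auto simp: graph_on_def)
    show ?case
      using IH insert.hyps insert.prems card_comps_insert_merge[OF assms(1), of a b E]
      by (cases "(a, b) \<in> conn E") (auto simp: e comps_insert_redundant)
  qed
qed

text \<open>A walk can be shortened to a path by cutting out the part between two visits to the
  same vertex.\<close>

lemma conn_imp_path:
  assumes "(x, y) \<in> conn E"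
  obtains c where "c \<noteq> []" "hd c = x" "last c = y" "distinct c"
    "successively (\<lambda>u v. {u, v} \<in> E) c"
proof -
  have "\<exists>c. c \<noteq> [] \<and> hd c = x \<and> last c = y \<and> distinct c \<and> successively (\<lambda>u v. {u, v} \<in> E) c"
    using assms unfolding conn_def
  proof (induction rule: converse_rtrancl_induct)
    case base
    then show ?case by (intro exI[of _ "[y]"]) auto
  next
    case (step x z)
    then obtain c where c: "c \<noteq> []" "hd c = z" "last c = y" "distinct c"
      "successively (\<lambda>u v. {u, v} \<in> E) c" by auto
    show ?case
    proof (cases "x \<in> set c")
      case True
      then obtain us vs where "c = us @ x # vs" by (meson split_list)
      then show ?thesis using c
        by (intro exI[of _ "x # vs"]) (auto simp: successively_append_iff)
    next
      case False
      then show ?thesis using c step.hyps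
        by (intro exI[of _ "x # c"]) (auto simp: successively_Cons)
    qed
  qed
  then show thesis using that by blast
qed

lemma successively_imp_conn:
  assumes "successively (\<lambda>u v. {u, v} \<in> E) c" "c \<noteq> []"
  shows "(hd c, last c) \<in> conn E"
  using assms
proof (induction c)
  case (Cons x c)
  show ?case
  proof (cases "c = []")
    case False
    then have "{x, hd c} \<in> E" "(hd c, last c) \<in> conn E"
      using Cons by (auto simp: successively_Cons)
    then show ?thesis using False by (auto intro: conn_edge conn_trans)
  qed simp
qed simp

text \<open>The last edge of a cycle joins the end points of the path formed by the other edges;
  conversely, a path that avoids an edge and joins its end points closes up to a cycle.\<close>

lemma has_cycle_iff_redundant_edge:
  assumes "graph_on V E"
  shows "has_cycle E \<longleftrightarrow> (\<exists>x y. {x, y} \<in> E \<and> (x, y) \<in> conn (E - {{x, y}}))"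
proof
  assume "has_cycle E"
  then obtain c where c: "length c \<ge> 3" "distinct c"
    and E: "\<And>i. i < length c \<Longrightarrow> {c ! i, c ! ((i + 1) mod length c)} \<in> E"
    by (auto simp: has_cycle_def)
  define e where "e = {hd c, last c}"
  have "c \<noteq> []" using c by auto
  then have hl: "hd c = c ! 0" "last c = c ! (length c - 1)"
    by (simp_all add: hd_conv_nth last_conv_nth)
  have "length c - 1 + 1 = length c" "length c - 1 < length c" using c by simp_all
  then have "(length c - 1 + 1) mod length c = 0" "length c - 1 < length c" by simp_all
  then have "e \<in> E" using E[of "length c - 1"] by (simp add: e_def hl insert_commute)
  moreover have "successively (\<lambda>u v. {u, v} \<in> E - {e}) c"
    unfolding successively_conv_nth
  proof (intro allI impI)
    fix i assume i: "Suc i < length c"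
    have "{c ! i, c ! Suc i} \<noteq> e"
    proof
      assume "{c ! i, c ! Suc i} = e"
      then have "nth c ` {i, Suc i} = nth c ` {0, length c - 1}" by (simp add: e_def hl)
      moreover have "inj_on (nth c) {..<length c}" using c(2) by (intro inj_on_nth) auto
      moreover have "{i, Suc i} \<subseteq> {..<length c}" "{0, length c - 1} \<subseteq> {..<length c}"
        using i by auto
      ultimately have "{i, Suc i} = {0, length c - 1}" by (simp only: inj_on_image_eq_iff)
      then show False using c(1) by (auto simp: doubleton_eq_iff)
    qed
    then show "{c ! i, c ! Suc i} \<in> E - {e}" using E[of i] i by auto
  qed
  then have "(hd c, last c) \<in> conn (E - {e})"
    by (rule successively_imp_conn) (use c in auto)
  ultimately show "\<exists>x y. {x, y} \<in> E \<and> (x, y) \<in> conn (E - {{x, y}})"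
    unfolding e_def by blast
next
  assume "\<exists>x y. {x, y} \<in> E \<and> (x, y) \<in> conn (E - {{x, y}})"
  then obtain x y where xy: "{x, y} \<in> E" "(x, y) \<in> conn (E - {{x, y}})" by blast
  have ne: "x \<noteq> y" using xy(1) assms by (auto simp: graph_on_def)
  from conn_imp_path[OF xy(2)] obtain c where c: "c \<noteq> []" "hd c = x" "last c = y" "distinct c"
    "successively (\<lambda>u v. {u, v} \<in> E - {{x, y}}) c" .
  have hl: "x = c ! 0" "y = c ! (length c - 1)"
    using c by (auto simp: hd_conv_nth last_conv_nth)
  have "length c \<noteq> 0" "length c \<noteq> 1" using c ne hl by auto
  moreover have "length c \<noteq> 2"
  proof
    assume "length c = 2"
    then have "{c ! 0, c ! Suc 0} \<in> E - {{x, y}}"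
      using successively_nth[OF c(5), of 0] by simp
    then show False using hl \<open>length c = 2\<close> by simp
  qed
  ultimately have len: "length c \<ge> 3" by linarith
  have "{c ! i, c ! ((i + 1) mod length c)} \<in> E" if "i < length c" for i
  proof (cases "Suc i < length c")
    case True
    then show ?thesis using successively_nth[OF c(5), of i] by auto
  next
    case False
    then have "i = length c - 1" using that by simp
    then have "i + 1 = length c" using len by simp
    then show ?thesis using xy(1) hl \<open>i = length c - 1\<close> by (simp add: insert_commute)
  qed
  then show "has_cycle E" unfolding has_cycle_def using c(4) len by blast
qed

lemma has_cycle_mono: "has_cycle E \<Longrightarrow> E \<subseteq> F \<Longrightarrow> has_cycle F"
  unfolding has_cycle_def by blast

text \<open>An edge is wasted in the count of components exactly if it joins two vertices that the
  other edges already connect, that is, if it lies on a cycle.\<close>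

lemma acyclic_iff_card:
  assumes "finite V" "graph_on V E"
  shows "\<not> has_cycle E \<longleftrightarrow> card V = card (comps V E) + card E"
proof
  assume eq: "card V = card (comps V E) + card E"
  show "\<not> has_cycle E"
  proof
    assume "has_cycle E"
    then obtain x y where xy: "{x, y} \<in> E" "(x, y) \<in> conn (E - {{x, y}})"
      using has_cycle_iff_redundant_edge[OF assms(2)] by blast
    have "comps V E = comps V (E - {{x, y}})"
      using comps_insert_redundant[OF xy(2)] xy(1) by (simp add: insert_absorb)
    moreover have "card V \<le> card (comps V (E - {{x, y}})) + card (E - {{x, y}})"
      by (intro card_le_comps_plus_edges assms graph_on_subset[OF assms(2)]) auto
    moreover have "card (E - {{x, y}}) < card E"
      by (intro card_Diff1_less graph_on_finite[OF assms] xy)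
    ultimately show False using eq by simp
  qed
next
  have "finite E" using assms by (rule graph_on_finite)
  moreover assume "\<not> has_cycle E"
  ultimately show "card V = card (comps V E) + card E" using assms(2)
  proof (induction E)
    case empty
    show ?case by (simp add: comps_empty card_image)
  next
    case (insert e E)
    obtain a b where e: "e = {a, b}" using graph_on_edge[OF insert.prems(2), of e] by blast
    have IH: "card V = card (comps V E) + card E"
      using insert.IH insert.prems has_cycle_mono[of E "insert e E"]
      by (auto simp: graph_on_def)
    have "(a, b) \<notin> conn E"
    proof
      assume "(a, b) \<in> conn E"
      moreover have "insert e E - {{a, b}} = E" using insert.hyps by (auto simp: e)
      ultimately have "{a, b} \<in> insert e E \<and> (a, b) \<in> conn (insert e E - {{a, b}})"
        by (simp add: e)
      then show False
        using insert.prems(1) unfolding has_cycle_iff_redundant_edge[OF insert.prems(2)] by blast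
    qed
    then show ?case
      using IH insert.hyps insert.prems(2) card_comps_insert_merge[OF assms(1), of a b E]
      unfolding e by simp
  qed
qed

lemma is_tree_card:
  assumes "is_tree V E"
  shows "Suc (card E) = card V"
proof -
  have t: "finite V" "V \<noteq> {}" "graph_on V E" "V \<times> V \<subseteq> conn E" "\<not> has_cycle E"
    using assms by (auto simp: is_tree_iff)
  have "comps V E = {V}"
    by (rule comps_eqI[OF t(3) partition_on_space[OF t(2)]])
       (use t in \<open>auto simp: graph_on_def\<close>)
  then show ?thesis using acyclic_iff_card[OF t(1,3)] t(5) by simp
qed

text \<open>The star with centre \<^term>\<open>c\<close>: a cycle would have three consecutive edges, which cannot
  all contain \<^term>\<open>c\<close>.\<close>

lemma is_tree_star:
  assumes "finite V" "c \<in> V"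
  shows "is_tree V ((\<lambda>k. {c, k}) ` (V - {c}))" (is "is_tree V ?E")
  unfolding is_tree_iff
proof (intro conjI)
  show "graph_on V ?E" using assms by (auto simp: graph_on_def card_2_iff)
  have "(c, k) \<in> conn ?E" if "k \<in> V" for k
    using that by (cases "k = c") (auto intro: conn_edge)
  then show "V \<times> V \<subseteq> conn ?E" by (auto intro: conn_sym conn_trans)
  show "\<not> has_cycle ?E"
  proof
    assume "has_cycle ?E"
    then obtain d where d: "length d \<ge> 3" "distinct d"
      "\<And>i. i < length d \<Longrightarrow> {d ! i, d ! ((i + 1) mod length d)} \<in> ?E"
      by (auto simp: has_cycle_def)
    have mem: "c \<in> {d ! i, d ! ((i + 1) mod length d)}" if "i < length d" for i
      using d(3)[OF that] by auto
    have lt: "0 < length d" "1 < length d" "2 < length d" using d(1) by linarith+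
    have "(0 + 1) mod length d = 1" "(1 + 1) mod length d = 2" "(2 + 1) mod length d = 3 mod length d"
      using lt by simp_all
    then have "c = d ! 0 \<or> c = d ! 1" "c = d ! 1 \<or> c = d ! 2"
      "c = d ! 2 \<or> c = d ! (3 mod length d)"
      using mem[OF lt(1)] mem[OF lt(2)] mem[OF lt(3)] by auto
    moreover have "3 mod length d \<noteq> 1" using d(1) by (cases "length d = 3") auto
    then have "d ! 0 \<noteq> d ! 1" "d ! 1 \<noteq> d ! 2" "d ! 0 \<noteq> d ! 2" "d ! 1 \<noteq> d ! (3 mod length d)"
      using d(2) lt by (auto simp: nth_eq_iff_index_eq)
    ultimately show False by metis
  qed
qed (use assms in auto)


section \<open>Monomials and polynomials\<close>

(* A variable has the exponent vector single S 1; the rules about it would no longer match after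
   rewriting 1 to Suc 0. *)
declare One_nat_def [simp del]

lemma graph_on_iff_pairs: "graph_on {1..n} E \<longleftrightarrow> E \<subseteq> pairs n"
  by (auto simp: graph_on_def pairs_def)

lemma finite_pairs [simp]: "finite (pairs n)"
  by (rule finite_subset[of _ "Pow {1..n}"]) (auto simp: pairs_def)

lemma keys_add_expo: "Poly_Mapping.keys (t + u :: expo) = Poly_Mapping.keys t \<union> Poly_Mapping.keys u"
  by (auto simp: in_keys_iff lookup_add)

lemma expo_deg_0 [simp]: "expo_deg 0 = 0"
  by (simp add: expo_deg_def)

lemma expo_deg_add: "expo_deg (t + u) = expo_deg t + expo_deg u"
  unfolding expo_deg_def by (rule setsum_keys_plus_distrib) auto

lemma expo_deg_sum: "expo_deg (sum f A) = (\<Sum>a\<in>A. expo_deg (f a))"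
  by (induction A rule: infinite_finite_induct) (auto simp: expo_deg_add)

lemma expo_deg_single [simp]: "expo_deg (Poly_Mapping.single S 1) = 1"
  by (simp add: expo_deg_def)

lemma expo_deg_ge_card_keys: "card (Poly_Mapping.keys t) \<le> expo_deg t"
proof -
  have "(\<Sum>S\<in>Poly_Mapping.keys t. 1) \<le> expo_deg t"
    unfolding expo_deg_def by (rule sum_mono) (auto simp: in_keys_iff)
  then show ?thesis by simp
qed

lemma lookup_graph_monomial:
  "finite E \<Longrightarrow> Poly_Mapping.lookup (graph_monomial E) S = (if S \<in> E then 1 else 0)"
  by (simp add: graph_monomial_def lookup_sum lookup_single when_def)

lemma keys_graph_monomial [simp]: "finite E \<Longrightarrow> Poly_Mapping.keys (graph_monomial E) = E"
  by (auto simp: in_keys_iff lookup_graph_monomial split: if_splits)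

lemma expo_deg_graph_monomial: "expo_deg (graph_monomial E) = card E"
  by (simp add: graph_monomial_def expo_deg_sum)

text \<open>All exponents in the support are at least 1, so the degree equals the size of the support
  only if all of them are 1.\<close>

lemma eq_graph_monomial_keys:
  assumes "expo_deg t = card (Poly_Mapping.keys t)"
  shows "t = graph_monomial (Poly_Mapping.keys t)"
proof (rule poly_mapping_eqI)
  fix S
  have le: "1 \<le> Poly_Mapping.lookup t S" if "S \<in> Poly_Mapping.keys t" for S
    using that by (auto simp: in_keys_iff)
  have "Poly_Mapping.lookup t S = 1" if "S \<in> Poly_Mapping.keys t" for S
  proof (rule ccontr)
    assume "Poly_Mapping.lookup t S \<noteq> 1"
    then have "(\<Sum>S\<in>Poly_Mapping.keys t. 1) < expo_deg t"
      unfolding expo_deg_def using le that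
      by (intro sum_strict_mono_ex1) (force intro!: bexI[of _ S])+
    then show False using assms by simp
  qed
  then show "Poly_Mapping.lookup t S =
      Poly_Mapping.lookup (graph_monomial (Poly_Mapping.keys t)) S"
    by (auto simp: lookup_graph_monomial in_keys_iff)
qed

lemma zero_in_monomials [simp]: "0 \<in> monomials n"
  by (simp add: monomials_def)

lemma add_in_monomials_iff [simp]:
  "t + u \<in> monomials n \<longleftrightarrow> t \<in> monomials n \<and> u \<in> monomials n"
  by (auto simp: monomials_def keys_add_expo)

lemma single_in_monomials_iff [simp]:
  "Poly_Mapping.single S 1 \<in> monomials n \<longleftrightarrow> S \<in> pairs n"
  by (simp add: monomials_def)

lemma sum_in_monomials: "(\<And>a. a \<in> A \<Longrightarrow> f a \<in> monomials n) \<Longrightarrow> sum f A \<in> monomials n"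
  by (induction A rule: infinite_finite_induct) auto

lemma graph_monomial_in_monomials: "E \<subseteq> pairs n \<Longrightarrow> graph_monomial E \<in> monomials n"
  unfolding graph_monomial_def by (rule sum_in_monomials) auto

lemma monomial_induct [consumes 1, case_names zero add]:
  assumes "t \<in> monomials n" "P 0"
    and step: "\<And>t S. t \<in> monomials n \<Longrightarrow> S \<in> pairs n \<Longrightarrow> P t \<Longrightarrow> P (t + Poly_Mapping.single S 1)"
  shows "P t"
  using assms(1)
proof (induction "expo_deg t" arbitrary: t)
  case 0
  have "Poly_Mapping.keys t = {}"
    using expo_deg_ge_card_keys[of t] 0 by simp
  then show ?case using assms(2) by simp
next
  case (Suc d)
  have "t \<noteq> 0" using Suc.hyps(2) by auto
  then obtain S where S: "S \<in> Poly_Mapping.keys t" by fastforce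
  define u where "u = t - Poly_Mapping.single S 1"
  have t: "t = u + Poly_Mapping.single S 1"
    by (rule poly_mapping_eqI)
       (use S in \<open>auto simp: u_def lookup_add lookup_minus lookup_single when_def in_keys_iff\<close>)
  have "u \<in> monomials n" "S \<in> pairs n"
    using Suc.prems S t by (auto simp: monomials_def keys_add_expo)
  moreover have "d = expo_deg u" using Suc.hyps(2) t by (simp add: expo_deg_add)
  ultimately show ?case using Suc.hyps(1) step t by blast
qed

lemma poly_ring_simps [simp]:
  "carrier (poly_ring n) = {f. Poly_Mapping.keys f \<subseteq> monomials n}"
  "mult (poly_ring n) = (*)" "one (poly_ring n) = 1" "zero (poly_ring n) = 0"
  "add (poly_ring n) = (+)"
  by (simp_all add: poly_ring_def)

lemma poly_ring_is_ring: "ring (poly_ring n)"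
  using poly_ring_cring by (simp add: cring_def)

lemma poly_ring_uminus:
  assumes "f \<in> carrier (poly_ring n)"
  shows "\<ominus>\<^bsub>poly_ring n\<^esub> f = - f"
proof -
  interpret ring "poly_ring n" by (rule poly_ring_is_ring)
  show ?thesis
    by (rule minus_equality) (use assms in auto)
qed

lemma poly_ring_minus:
  "f \<in> carrier (poly_ring n) \<Longrightarrow> g \<in> carrier (poly_ring n) \<Longrightarrow> f \<ominus>\<^bsub>poly_ring n\<^esub> g = f - g"
  by (simp add: a_minus_def poly_ring_uminus)

lemma keys_sum_subset:
  "(\<And>a. a \<in> A \<Longrightarrow> Poly_Mapping.keys (f a) \<subseteq> K) \<Longrightarrow> Poly_Mapping.keys (sum f A) \<subseteq> K"
proof (induction A rule: infinite_finite_induct)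
  case (insert a A)
  then show ?case using Poly_Mapping.keys_add[of "f a" "sum f A"] by auto
qed auto

lemma keys_diff_subset:
  "Poly_Mapping.keys f \<subseteq> K \<Longrightarrow> Poly_Mapping.keys g \<subseteq> K \<Longrightarrow> Poly_Mapping.keys (f - g :: mpoly) \<subseteq> K"
  unfolding subset_iff in_keys_iff lookup_minus by (metis diff_zero)

lemma keys_Monomial [simp]: "Poly_Mapping.keys (Monomial t) = {t}"
  by (simp add: Monomial_def)

lemma Monomial_neq_0 [simp]: "Monomial t \<noteq> 0"
  using keys_Monomial[of t] by (metis keys_zero insert_not_empty)

lemma Monomial_mult: "Monomial t * Monomial u = Monomial (t + u)"
  by (simp add: Monomial_def mult_single)

lemma single_mult_Monomial: "Poly_Mapping.single u c * Monomial t = Poly_Mapping.single (u + t) c"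
  by (simp add: Monomial_def mult_single)

lemma Const_mult_Monomial: "Const c * Monomial t = Poly_Mapping.single t c"
  by (simp add: Const_def single_mult_Monomial)

lemma sum_singles: "(\<Sum>t\<in>Poly_Mapping.keys f. Poly_Mapping.single t (Poly_Mapping.lookup f t)) = f"
  by (rule poly_mapping_eqI) (auto simp: lookup_sum lookup_single when_def in_keys_iff)

lemma keys_mult_subset:
  assumes "\<And>u v. u \<in> Poly_Mapping.keys f \<Longrightarrow> v \<in> Poly_Mapping.keys g \<Longrightarrow> u + v \<in> K"
  shows "Poly_Mapping.keys (f * g :: mpoly) \<subseteq> K"
  using Poly_Mapping.keys_mult[of f g] assms by blast

lemma keys_Monomial_mult: "Poly_Mapping.keys (Monomial u * f) = (+) u ` Poly_Mapping.keys f"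
proof -
  have "Monomial u * f =
      (\<Sum>t\<in>Poly_Mapping.keys f. Poly_Mapping.single (u + t) (Poly_Mapping.lookup f t))"
    by (subst (1) sum_singles[of f, symmetric]) (simp add: sum_distrib_left Monomial_def mult_single)
  then have lookup: "Poly_Mapping.lookup (Monomial u * f) s =
      (\<Sum>t\<in>Poly_Mapping.keys f. if u + t = s then Poly_Mapping.lookup f t else 0)" for s
    by (simp add: lookup_sum lookup_single when_def)
  have "Poly_Mapping.lookup (Monomial u * f) (u + t) = Poly_Mapping.lookup f t" for t
    unfolding lookup by (auto simp: in_keys_iff)
  moreover have "Poly_Mapping.lookup (Monomial u * f) s = 0" if "s \<notin> (+) u ` Poly_Mapping.keys f" for s
    unfolding lookup using that by (intro sum.neutral) auto
  ultimately have "s \<in> Poly_Mapping.keys (Monomial u * f) \<longleftrightarrow> s \<in> (+) u ` Poly_Mapping.keys f" for s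
    by (cases "s \<in> (+) u ` Poly_Mapping.keys f") (auto simp: in_keys_iff)
  then show ?thesis by blast
qed

text \<open>The linear functional on polynomials whose value at each monomial is prescribed.
  Evaluation at a point is of this form, and so are the functionals that cut out the tree ideal.\<close>

definition weighted_sum :: "(expo \<Rightarrow> complex) \<Rightarrow> mpoly \<Rightarrow> complex" where
  "weighted_sum w f = (\<Sum>t\<in>Poly_Mapping.keys f. Poly_Mapping.lookup f t * w t)"

lemma weighted_sum_superset:
  "finite A \<Longrightarrow> Poly_Mapping.keys f \<subseteq> A \<Longrightarrow> weighted_sum w f = (\<Sum>t\<in>A. Poly_Mapping.lookup f t * w t)"
  unfolding weighted_sum_def by (rule sum.mono_neutral_left) (auto simp: in_keys_iff)

lemma weighted_sum_add: "weighted_sum w (f + g) = weighted_sum w f + weighted_sum w g"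
  unfolding weighted_sum_def by (rule setsum_keys_plus_distrib) (auto simp: algebra_simps)

lemma weighted_sum_0 [simp]: "weighted_sum w 0 = 0"
  by (simp add: weighted_sum_def)

lemma weighted_sum_uminus: "weighted_sum w (- f) = - weighted_sum w f"
  by (simp add: weighted_sum_def sum_negf)

lemma weighted_sum_diff: "weighted_sum w (f - g) = weighted_sum w f - weighted_sum w g"
  using weighted_sum_add[of w f "- g"] by (simp add: weighted_sum_uminus)

lemma weighted_sum_sum: "weighted_sum w (sum f A) = (\<Sum>a\<in>A. weighted_sum w (f a))"
  by (induction A rule: infinite_finite_induct) (auto simp: weighted_sum_add)

lemma weighted_sum_single [simp]: "weighted_sum w (Poly_Mapping.single t c) = c * w t"
  by (simp add: weighted_sum_def)

lemma weighted_sum_Monomial [simp]: "weighted_sum w (Monomial t) = w t"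
  by (simp add: Monomial_def)

lemma weighted_sum_single_mult:
  "weighted_sum w (Poly_Mapping.single u c * f) = c * weighted_sum (\<lambda>t. w (u + t)) f"
proof -
  have "Poly_Mapping.single u c * f =
      (\<Sum>t\<in>Poly_Mapping.keys f. Poly_Mapping.single (u + t) (c * Poly_Mapping.lookup f t))"
    by (subst (1) sum_singles[of f, symmetric]) (simp add: sum_distrib_left mult_single)
  then show ?thesis
    by (simp add: weighted_sum_sum weighted_sum_def[of _ f] sum_distrib_left mult.assoc)
qed

lemma weighted_sum_cong:
  "(\<And>t. t \<in> Poly_Mapping.keys f \<Longrightarrow> w t = w' t) \<Longrightarrow> weighted_sum w f = weighted_sum w' f"
  unfolding weighted_sum_def by (rule sum.cong) auto

lemma weighted_sum_sum_weights:
  "weighted_sum (\<lambda>t. \<Sum>a\<in>A. w a t) f = (\<Sum>a\<in>A. weighted_sum (w a) f)"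
  unfolding weighted_sum_def sum_distrib_left by (rule sum.swap)

section \<open>Ideals of the polynomial ring\<close>

text \<open>Every polynomial is a sum of scaled monomials, so it suffices to absorb these.\<close>

lemma poly_idealI:
  assumes "K \<subseteq> carrier (poly_ring n)" "0 \<in> K"
    and add: "\<And>f g. f \<in> K \<Longrightarrow> g \<in> K \<Longrightarrow> f + g \<in> K"
    and mult: "\<And>f u c. f \<in> K \<Longrightarrow> u \<in> monomials n \<Longrightarrow> Poly_Mapping.single u c * f \<in> K"
  shows "ideal K (poly_ring n)"
proof -
  have mult': "g * f \<in> K" if "f \<in> K" "g \<in> carrier (poly_ring n)" for f g
  proof -
    have "(\<Sum>u\<in>A. Poly_Mapping.single u (Poly_Mapping.lookup g u) * f) \<in> K"
      if "finite A" "A \<subseteq> monomials n" for A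
      using that by (induction A) (auto intro!: add mult assms(2) \<open>f \<in> K\<close>)
    from this[of "Poly_Mapping.keys g"] have
      "(\<Sum>u\<in>Poly_Mapping.keys g. Poly_Mapping.single u (Poly_Mapping.lookup g u)) * f \<in> K"
      using that by (simp add: sum_distrib_right)
    then show ?thesis by (simp add: sum_singles)
  qed
  have neg: "- f \<in> K" if "f \<in> K" for f
  proof -
    have "- f = Poly_Mapping.single 0 (-1) * f" by (simp add: single_uminus)
    then show ?thesis using mult[OF that, of 0 "-1"] by simp
  qed
  interpret R: ring "poly_ring n" by (rule poly_ring_is_ring)
  show ?thesis
  proof (rule idealI[OF poly_ring_is_ring])
    show "subgroup K (add_monoid (poly_ring n))"
    proof (rule R.add.subgroupI)
      fix f assume "f \<in> K"
      then show "\<ominus>\<^bsub>poly_ring n\<^esub> f \<in> K"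
        using assms(1) neg poly_ring_uminus[of f n] by auto
    qed (use assms in auto)
  qed (use mult' in \<open>auto simp: mult.commute\<close>)
qed

context
  fixes n :: nat and I :: "mpoly set"
  assumes ideal: "ideal I (poly_ring n)"
begin

lemma poly_ideal_subset: "f \<in> I \<Longrightarrow> Poly_Mapping.keys f \<subseteq> monomials n"
  using ideal.Icarr[OF ideal] by simp

lemma poly_ideal_0: "0 \<in> I"
  using additive_subgroup.zero_closed[OF ideal.axioms(1)[OF ideal]] by simp

lemma poly_ideal_add: "f \<in> I \<Longrightarrow> g \<in> I \<Longrightarrow> f + g \<in> I"
  using additive_subgroup.a_closed[OF ideal.axioms(1)[OF ideal]] by simp

lemma poly_ideal_mult: "f \<in> I \<Longrightarrow> Poly_Mapping.keys g \<subseteq> monomials n \<Longrightarrow> g * f \<in> I"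
  using ideal.I_l_closed[OF ideal] by simp

lemma poly_ideal_uminus: "f \<in> I \<Longrightarrow> - f \<in> I"
  using poly_ideal_mult[of f "- 1"] by simp

lemma poly_ideal_sum: "(\<And>a. a \<in> A \<Longrightarrow> f a \<in> I) \<Longrightarrow> sum f A \<in> I"
  by (induction A rule: infinite_finite_induct) (auto intro: poly_ideal_0 poly_ideal_add)

lemma poly_ideal_coset_eq_iff:
  assumes "Poly_Mapping.keys f \<subseteq> monomials n" "Poly_Mapping.keys g \<subseteq> monomials n"
  shows "I +>\<^bsub>poly_ring n\<^esub> f = I +>\<^bsub>poly_ring n\<^esub> g \<longleftrightarrow> f - g \<in> I"
  using ring.quotient_eq_iff_same_a_r_cos[OF poly_ring_is_ring ideal, of f g] assms
  by (simp add: poly_ring_minus)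

end


section \<open>Straightening monomials modulo the tree ideal\<close>

definition components :: "nat \<Rightarrow> expo \<Rightarrow> nat set set" where
  "components n t = comps {1..n} (Poly_Mapping.keys t)"

definition tree_cong :: "nat \<Rightarrow> nat \<Rightarrow> expo \<Rightarrow> expo \<Rightarrow> bool" where
  "tree_cong n m t u \<longleftrightarrow> Monomial t - Monomial u \<in> tree_ideal n m"

definition star :: "nat \<Rightarrow> nat set \<Rightarrow> expo" where
  "star c B = (\<Sum>k\<in>B - {c}. Poly_Mapping.single {c, k} 1)"

text \<open>The centre is chosen only to make the monomial a function of the block: by
  \<open>tree_cong_recentre\<close>, any other centre gives a congruent monomial.\<close>

definition block_star :: "nat set \<Rightarrow> expo" where
  "block_star B = star (Min B) B"

lemma partition_on_components: "t \<in> monomials n \<Longrightarrow> partition_on {1..n} (components n t)"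
  unfolding components_def
  by (rule partition_on_comps) (simp add: graph_on_iff_pairs monomials_def)

lemma finite_components [simp]: "finite (components n t)"
  by (simp add: components_def finite_comps)

lemma pair_in_pairs [simp]: "{a, b} \<in> pairs n \<longleftrightarrow> a \<in> {1..n} \<and> b \<in> {1..n} \<and> a \<noteq> b"
  by (auto simp: pairs_def card_2_iff doubleton_eq_iff)

lemma pairsE:
  assumes "S \<in> pairs n"
  obtains a b where "S = {a, b}" "a \<in> {1..n}" "b \<in> {1..n}" "a \<noteq> b"
  using assms unfolding pairs_def by (auto simp: card_2_iff)

lemma Var_mult: "Var S * Var T = Monomial (Poly_Mapping.single S 1 + Poly_Mapping.single T 1)"
  by (simp add: Var_def Monomial_mult)

lemma tree_ideal_generators_subset:
  "{Var S ^ 2 |S. S \<in> pairs n} \<union>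
   {Var {i, j} * Var {j, k} - Var {i, k} * Var {j, k} |i j k.
         {i, j, k} \<subseteq> {1..n} \<and> i \<noteq> j \<and> j \<noteq> k \<and> i \<noteq> k} \<union>
   {Monomial (graph_monomial E) |V E. V \<subseteq> {1..n} \<and> card V = m + 1 \<and> is_tree V E}
   \<subseteq> carrier (poly_ring n)" (is "?A \<union> ?B \<union> ?C \<subseteq> _")
proof (intro Un_least)
  show "?A \<subseteq> carrier (poly_ring n)" by (auto simp: power2_eq_square Var_mult)
  show "?B \<subseteq> carrier (poly_ring n)"
  proof (clarify)
    fix i j k assume "{i, j, k} \<subseteq> {1..n}" "i \<noteq> j" "j \<noteq> k" "i \<noteq> k"
    then show "Var {i, j} * Var {j, k} - Var {i, k} * Var {j, k} \<in> carrier (poly_ring n)"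
      unfolding Var_mult poly_ring_simps mem_Collect_eq by (intro keys_diff_subset) auto
  qed
  show "?C \<subseteq> carrier (poly_ring n)"
  proof (clarify)
    fix V E assume "V \<subseteq> {1..n}" "is_tree V E"
    then have "E \<subseteq> pairs n" by (auto simp: is_tree_def pairs_def)
    then show "Monomial (graph_monomial E) \<in> carrier (poly_ring n)"
      by (simp add: graph_monomial_in_monomials)
  qed
qed

lemma tree_ideal_ideal: "ideal (tree_ideal n m) (poly_ring n)"
  unfolding tree_ideal_def
  by (rule ring.genideal_ideal[OF poly_ring_is_ring tree_ideal_generators_subset])

lemma tree_ideal_minimal:
  assumes "ideal K (poly_ring n)"
    and "\<And>S. S \<in> pairs n \<Longrightarrow> Var S ^ 2 \<in> K"
    and "\<And>i j k. {i, j, k} \<subseteq> {1..n} \<Longrightarrow> i \<noteq> j \<Longrightarrow> j \<noteq> k \<Longrightarrow> i \<noteq> k \<Longrightarrow>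
          Var {i, j} * Var {j, k} - Var {i, k} * Var {j, k} \<in> K"
    and "\<And>V E. V \<subseteq> {1..n} \<Longrightarrow> card V = m + 1 \<Longrightarrow> is_tree V E \<Longrightarrow>
          Monomial (graph_monomial E) \<in> K"
  shows "tree_ideal n m \<subseteq> K"
  unfolding tree_ideal_def
  by (rule ring.genideal_minimal[OF poly_ring_is_ring assms(1)]) (use assms(2-4) in blast)

lemma tree_ideal_generators:
  shows "S \<in> pairs n \<Longrightarrow> Var S ^ 2 \<in> tree_ideal n m"
    and "{i, j, k} \<subseteq> {1..n} \<Longrightarrow> i \<noteq> j \<Longrightarrow> j \<noteq> k \<Longrightarrow> i \<noteq> k \<Longrightarrow>
          Var {i, j} * Var {j, k} - Var {i, k} * Var {j, k} \<in> tree_ideal n m"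
    and "V \<subseteq> {1..n} \<Longrightarrow> card V = m + 1 \<Longrightarrow> is_tree V E \<Longrightarrow>
          Monomial (graph_monomial E) \<in> tree_ideal n m"
proof -
  note self = subsetD[OF ring.genideal_self[OF poly_ring_is_ring
    tree_ideal_generators_subset[of n m]], folded tree_ideal_def]
  show "S \<in> pairs n \<Longrightarrow> Var S ^ 2 \<in> tree_ideal n m"
    by (rule self) blast
  show "{i, j, k} \<subseteq> {1..n} \<Longrightarrow> i \<noteq> j \<Longrightarrow> j \<noteq> k \<Longrightarrow> i \<noteq> k \<Longrightarrow>
      Var {i, j} * Var {j, k} - Var {i, k} * Var {j, k} \<in> tree_ideal n m"
    by (rule self) blast
  show "V \<subseteq> {1..n} \<Longrightarrow> card V = m + 1 \<Longrightarrow> is_tree V E \<Longrightarrow>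
      Monomial (graph_monomial E) \<in> tree_ideal n m"
    by (rule self) blast
qed

lemma tree_ideal_Monomial_add:
  "Monomial t \<in> tree_ideal n m \<Longrightarrow> u \<in> monomials n \<Longrightarrow> Monomial (t + u) \<in> tree_ideal n m"
  using poly_ideal_mult[OF tree_ideal_ideal, of "Monomial t" n m "Monomial u"]
  by (simp add: Monomial_mult add.commute)

lemma tree_cong_refl [simp]: "tree_cong n m t t"
  using poly_ideal_0[OF tree_ideal_ideal] by (simp add: tree_cong_def)

lemma tree_cong_sym: "tree_cong n m t u \<Longrightarrow> tree_cong n m u t"
  unfolding tree_cong_def using poly_ideal_uminus[OF tree_ideal_ideal] by fastforce

lemma tree_cong_trans [trans]: "tree_cong n m t u \<Longrightarrow> tree_cong n m u v \<Longrightarrow> tree_cong n m t v"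
  unfolding tree_cong_def using poly_ideal_add[OF tree_ideal_ideal] by fastforce

lemma tree_cong_add: "tree_cong n m t u \<Longrightarrow> v \<in> monomials n \<Longrightarrow> tree_cong n m (t + v) (u + v)"
  unfolding tree_cong_def
  using poly_ideal_mult[OF tree_ideal_ideal, of "Monomial t - Monomial u" n m "Monomial v"]
  by (simp add: right_diff_distrib Monomial_mult add.commute)

lemma tree_cong_in_ideal:
  "tree_cong n m t u \<Longrightarrow> Monomial u \<in> tree_ideal n m \<Longrightarrow> Monomial t \<in> tree_ideal n m"
  unfolding tree_cong_def using poly_ideal_add[OF tree_ideal_ideal] by fastforce

lemma star_in_monomials: "c \<in> B \<Longrightarrow> B \<subseteq> {1..n} \<Longrightarrow> star c B \<in> monomials n"
  unfolding star_def by (rule sum_in_monomials) auto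

lemma block_star_in_monomials: "B \<noteq> {} \<Longrightarrow> B \<subseteq> {1..n} \<Longrightarrow> block_star B \<in> monomials n"
  unfolding block_star_def
  by (intro star_in_monomials Min_in) (auto dest: finite_subset)

text \<open>In the presence of the edge \<open>{a, b}\<close> the differences
  \<open>x\<^sub>i\<^sub>j x\<^sub>j\<^sub>k - x\<^sub>i\<^sub>k x\<^sub>j\<^sub>k\<close> allow any other edge at \<^term>\<open>a\<close> to be moved to \<^term>\<open>b\<close>.\<close>

lemma tree_cong_move_edges:
  assumes "finite K" "K \<subseteq> {1..n} - {a, b}" "a \<in> {1..n}" "b \<in> {1..n}" "a \<noteq> b"
  shows "tree_cong n m
    (Poly_Mapping.single {a, b} 1 + (\<Sum>k\<in>K. Poly_Mapping.single {a, k} 1))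
    (Poly_Mapping.single {a, b} 1 + (\<Sum>k\<in>K. Poly_Mapping.single {b, k} 1))"
  using assms(1,2)
proof (induction K)
  case (insert k K)
  let ?x = "\<lambda>i j. Poly_Mapping.single {i, j} 1 :: expo"
  let ?sa = "\<Sum>k\<in>K. ?x a k" and ?sb = "\<Sum>k\<in>K. ?x b k"
  have k: "k \<in> {1..n}" "k \<noteq> a" "k \<noteq> b" using insert.prems by auto
  have "tree_cong n m (?x a b + ?sa + ?x a k) (?x a b + ?sb + ?x a k)"
    by (rule tree_cong_add) (use insert k assms in auto)
  moreover have "tree_cong n m (?x k a + ?x a b) (?x k b + ?x a b)"
    using tree_ideal_generators(2)[of k a b n m] k assms
    unfolding tree_cong_def Var_mult by simp
  then have "tree_cong n m (?x k a + ?x a b + ?sb) (?x k b + ?x a b + ?sb)"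
    by (rule tree_cong_add, intro sum_in_monomials) (use insert.prems assms in auto)
  moreover have "?x a b + ?sb + ?x a k = ?x k a + ?x a b + ?sb"
    by (simp only: insert_commute[of a k] ac_simps)
  ultimately have "tree_cong n m (?x a b + ?sa + ?x a k) (?x k b + ?x a b + ?sb)"
    by (auto intro: tree_cong_trans)
  then show ?case
    using insert.hyps by (simp add: ac_simps insert_commute)
qed simp

lemma star_remove: "finite B \<Longrightarrow> b \<in> B \<Longrightarrow> a \<noteq> b \<Longrightarrow>
    star a B = Poly_Mapping.single {a, b} 1 + (\<Sum>k\<in>B - {a, b}. Poly_Mapping.single {a, k} 1)"
proof -
  assume "finite B" "b \<in> B" "a \<noteq> b"
  moreover have "B - {a} - {b} = B - {a, b}" by auto
  ultimately show ?thesis unfolding star_def by (subst sum.remove[of _ b]) auto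
qed

lemma tree_cong_recentre:
  assumes "B \<subseteq> {1..n}" "a \<in> B" "b \<in> B"
  shows "tree_cong n m (star a B) (star b B)"
proof (cases "a = b")
  case False
  have "finite B" using assms(1) by (rule finite_subset) simp
  then have "star a B = Poly_Mapping.single {a, b} 1 + (\<Sum>k\<in>B - {a, b}. Poly_Mapping.single {a, k} 1)"
    "star b B = Poly_Mapping.single {a, b} 1 + (\<Sum>k\<in>B - {a, b}. Poly_Mapping.single {b, k} 1)"
    using assms False star_remove[of B b a] star_remove[of B a b] by (simp_all add: insert_commute)
  then show ?thesis
    using tree_cong_move_edges[of "B - {a, b}" n a b m] assms False \<open>finite B\<close>
    by (auto simp: subset_iff)
qed simp

lemma tree_cong_block_star:
  assumes "B \<subseteq> {1..n}" "a \<in> B"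
  shows "tree_cong n m (star a B) (block_star B)"
proof -
  have "finite B" using assms(1) by (rule finite_subset) simp
  then have "Min B \<in> B" using assms(2) by (auto intro: Min_in)
  then show ?thesis unfolding block_star_def using assms by (intro tree_cong_recentre)
qed

text \<open>Both stars are recentred at the end points of the connecting edge, which then allows the
  edges at \<^term>\<open>b\<close> to be moved to \<^term>\<open>a\<close>.\<close>

lemma tree_cong_merge:
  assumes "A \<subseteq> {1..n}" "B \<subseteq> {1..n}" "A \<inter> B = {}" "a \<in> A" "b \<in> B"
  shows "tree_cong n m (block_star A + block_star B + Poly_Mapping.single {a, b} 1)
    (block_star (A \<union> B))"
proof -
  let ?x = "Poly_Mapping.single {a, b} 1 :: expo"
  have fin: "finite A" "finite B" using assms finite_subset[of _ "{1..n}"] by auto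
  have ab: "a \<in> {1..n}" "b \<in> {1..n}" "a \<noteq> b" using assms by auto
  have mon: "star a A \<in> monomials n" "block_star B \<in> monomials n" "?x \<in> monomials n"
    using assms ab by (auto intro: star_in_monomials block_star_in_monomials)
  have "tree_cong n m (block_star A + (block_star B + ?x)) (star a A + (block_star B + ?x))"
    by (rule tree_cong_add[OF tree_cong_sym[OF tree_cong_block_star]]) (use assms mon in auto)
  also have "tree_cong n m (block_star B + (star a A + ?x)) (star b B + (star a A + ?x))"
    by (rule tree_cong_add[OF tree_cong_sym[OF tree_cong_block_star]]) (use assms mon in auto)
  then have "tree_cong n m (star a A + (block_star B + ?x)) (?x + star b B + star a A)"
    by (simp add: ac_simps)
  also have "tree_cong n m (?x + star b B + star a A)
      (?x + (\<Sum>k\<in>B - {b}. Poly_Mapping.single {a, k} 1) + star a A)"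
    using tree_cong_move_edges[of "B - {b}" n b a m] assms ab fin mon
    by (intro tree_cong_add) (auto simp: star_def insert_commute)
  also have "?x + (\<Sum>k\<in>B - {b}. Poly_Mapping.single {a, k} 1) + star a A = star a (A \<union> B)"
  proof -
    have "A \<union> B - {a} = (A - {a}) \<union> B" using assms by auto
    moreover have "(A - {a}) \<inter> B = {}" using assms by auto
    ultimately have "star a (A \<union> B) = star a A + (\<Sum>k\<in>B. Poly_Mapping.single {a, k} 1)"
      unfolding star_def using fin by (simp add: sum.union_disjoint)
    then show ?thesis
      using fin assms by (simp add: sum.remove[of B b] ac_simps)
  qed
  also have "tree_cong n m (star a (A \<union> B)) (block_star (A \<union> B))"
    by (rule tree_cong_block_star) (use assms in auto)
  finally show ?thesis by (simp add: ac_simps)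
qed

lemma components_add_single:
  "components n (t + Poly_Mapping.single {a, b} 1) =
     comps {1..n} (insert {a, b} (Poly_Mapping.keys t))"
  by (simp add: components_def keys_add_expo)

text \<open>The variables of the monomial are multiplied one at a time. A variable joining two components
  merges their stars and preserves the sum of the number of components and the degree; a
  variable within a component produces a square and increases that sum. The sum starts at
  \<^term>\<open>n\<close>, so it tells whether the second case has ever occurred.\<close>

lemma tree_ideal_or_cong_block_stars:
  assumes "t \<in> monomials n"
  shows "n = card (components n t) + expo_deg t \<and>
      tree_cong n m t (\<Sum>B\<in>components n t. block_star B) \<or>
    n < card (components n t) + expo_deg t \<and> Monomial t \<in> tree_ideal n m"
  using assms
proof (induction t rule: monomial_induct)
  case zero
  show ?case
    by (simp add: components_def comps_empty card_image sum.reindex block_star_def star_def)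
next
  case (add t S)
  obtain a b where S: "S = {a, b}" and ab: "a \<in> {1..n}" "b \<in> {1..n}" "a \<noteq> b"
    using add.hyps(2) by (rule pairsE)
  let ?E = "Poly_Mapping.keys t" and ?x = "Poly_Mapping.single {a, b} 1 :: expo"
  define C D where "C = conn ?E `` {a}" and "D = conn ?E `` {b}"
  define P where "P = components n t"
  have g: "graph_on {1..n} (insert {a, b} ?E)" "graph_on {1..n} ?E"
    using add.hyps ab by (auto simp: graph_on_iff_pairs monomials_def)
  have P: "partition_on {1..n} P"
    unfolding P_def using add.hyps(1) by (rule partition_on_components)
  have CD: "C \<in> P" "D \<in> P" "a \<in> C" "b \<in> D"
    using ab by (auto simp: P_def C_def D_def components_def comps_def)
  have sub: "B \<subseteq> {1..n}" "B \<noteq> {}" if "B \<in> P" for B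
    using that partition_onD1[OF P] partition_onD3[OF P] by auto
  have fin: "finite P" by (simp add: P_def)
  have x: "?x \<in> monomials n" using ab by simp
  have sum_mon: "sum block_star Q \<in> monomials n" if "Q \<subseteq> P" for Q
    using that sub by (intro sum_in_monomials block_star_in_monomials) auto
  show ?case
  proof (cases "(a, b) \<in> conn ?E")
    case True
    have comp: "components n (t + ?x) = P"
      using True unfolding components_add_single P_def
      by (simp add: comps_insert_redundant components_def)
    have bC: "b \<in> C" using True by (simp add: C_def)
    \<comment> \<open>The edge closes a cycle: recentring the star of its component at one end point
      produces the square of its variable.\<close>
    have "Monomial (t + ?x) \<in> tree_ideal n m"
      using add.IH
    proof (elim disjE conjE)
      assume "Monomial t \<in> tree_ideal n m"
      then show ?thesis using x by (rule tree_ideal_Monomial_add)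
    next
      assume t: "tree_cong n m t (\<Sum>B\<in>components n t. block_star B)"
      let ?r = "\<Sum>B\<in>P - {C}. block_star B"
      have split: "(\<Sum>B\<in>components n t. block_star B) = block_star C + ?r"
        using CD fin by (simp add: P_def sum.remove)
      have "tree_cong n m (t + ?x) (block_star C + ?r + ?x)"
        using t x unfolding split by (rule tree_cong_add)
      also have "tree_cong n m (block_star C + (?r + ?x)) (star a C + (?r + ?x))"
        by (intro tree_cong_add[OF tree_cong_sym[OF tree_cong_block_star]])
           (use CD sub x sum_mon[of "P - {C}"] in auto)
      then have "tree_cong n m (block_star C + ?r + ?x) (star a C + (?r + ?x))"
        by (simp add: ac_simps)
      finally have cong: "tree_cong n m (t + ?x) (star a C + (?r + ?x))" .
      let ?k = "\<Sum>k\<in>C - {a, b}. Poly_Mapping.single {a, k} 1"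
      have "finite C" using sub[OF CD(1)] finite_subset[of _ "{1..n}"] by auto
      then have "star a C + (?r + ?x) = (?x + ?x) + (?k + ?r)"
        using bC ab by (simp add: star_remove ac_simps)
      moreover have "?k + ?r \<in> monomials n"
        using sub[OF CD(1)] ab sum_mon[of "P - {C}"] by (auto intro!: sum_in_monomials)
      moreover have "Monomial (?x + ?x) \<in> tree_ideal n m"
        using tree_ideal_generators(1)[of "{a, b}" n m] ab
        by (simp add: power2_eq_square Var_mult)
      ultimately have "Monomial (star a C + (?r + ?x)) \<in> tree_ideal n m"
        by (metis tree_ideal_Monomial_add)
      then show ?thesis using cong by (rule tree_cong_in_ideal[rotated])
    qed
    moreover have "n \<le> card P + expo_deg t" using add.IH by (auto simp: P_def)
    ultimately show ?thesis
      using comp by (simp add: S expo_deg_add)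
  next
    case False
    have ne: "C \<noteq> D" using False conn_class_eq[of ?E a b] by (simp add: C_def D_def)
    have comp: "components n (t + ?x) = insert (C \<union> D) (P - {C, D})"
      using comps_insert_merge[OF g(1)]
      unfolding components_add_single by (simp add: P_def components_def C_def D_def)
    have card: "Suc (card (components n (t + ?x))) = card P"
      using card_comps_insert_merge[OF _ g(1) False]
      unfolding components_add_single by (simp add: P_def components_def)
    have disj: "C \<inter> D = {}" using P CD ne by (auto simp: partition_on_def disjoint_def)
    have "C \<union> D \<notin> P"
      using partition_on_same_block[OF P, of "C \<union> D" C a]
        partition_on_same_block[OF P, of "C \<union> D" D b] CD ne by auto
    then have new: "(\<Sum>B\<in>components n (t + ?x). block_star B) =
        block_star (C \<union> D) + (\<Sum>B\<in>P - {C, D}. block_star B)"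
      unfolding comp using fin by (subst sum.insert) auto
    have old: "(\<Sum>B\<in>P. block_star B) =
        block_star C + (block_star D + (\<Sum>B\<in>P - {C, D}. block_star B))"
    proof -
      have "P - {C} - {D} = P - {C, D}" by auto
      then show ?thesis
        using fin CD ne by (simp add: sum.remove[of P C] sum.remove[of "P - {C}" D])
    qed
    let ?r = "\<Sum>B\<in>P - {C, D}. block_star B"
    have "tree_cong n m (t + ?x) (\<Sum>B\<in>components n (t + ?x). block_star B)"
      if "tree_cong n m t (\<Sum>B\<in>P. block_star B)"
    proof -
      have "tree_cong n m (t + ?x) ((\<Sum>B\<in>P. block_star B) + ?x)"
        using that x by (rule tree_cong_add)
      also have "tree_cong n m ((block_star C + block_star D + ?x) + ?r) (block_star (C \<union> D) + ?r)"
        by (intro tree_cong_add tree_cong_merge sum_mon) (use sub CD disj in auto)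
      then have "tree_cong n m ((\<Sum>B\<in>P. block_star B) + ?x) (block_star (C \<union> D) + ?r)"
        unfolding old by (simp add: ac_simps)
      finally show ?thesis unfolding new .
    qed
    moreover have "Monomial (t + ?x) \<in> tree_ideal n m" if "Monomial t \<in> tree_ideal n m"
      using that x by (rule tree_ideal_Monomial_add)
    moreover have "card (components n (t + ?x)) + expo_deg (t + ?x) = card P + expo_deg t"
      using card by (simp add: expo_deg_add)
    ultimately show ?thesis
      using add.IH unfolding S P_def[symmetric] by auto
  qed
qed

lemma components_degree_bound: "t \<in> monomials n \<Longrightarrow> n \<le> card (components n t) + expo_deg t"
  using card_le_comps_plus_edges[of "{1..n}" "Poly_Mapping.keys t"] expo_deg_ge_card_keys[of t]
  by (auto simp: components_def graph_on_iff_pairs monomials_def)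

text \<open>A star with more than \<^term>\<open>m\<close> vertices is divisible by one with exactly \<open>m + 1\<close> vertices.\<close>

lemma block_star_in_tree_ideal:
  assumes "B \<subseteq> {1..n}" "m < card B"
  shows "Monomial (block_star B) \<in> tree_ideal n m"
proof -
  define c where "c = Min B"
  have fin: "finite B" using assms(1) by (rule finite_subset) simp
  have "B \<noteq> {}" using assms(2) by auto
  then have c: "c \<in> B" unfolding c_def using fin by (intro Min_in)
  have "m \<le> card (B - {c})" using assms(2) c fin by simp
  then obtain W where W: "W \<subseteq> B - {c}" "card W = m" "finite W"
    by (rule obtain_subset_with_card_n)
  let ?E = "(\<lambda>k. {c, k}) ` W"
  have "is_tree (insert c W) ((\<lambda>k. {c, k}) ` (insert c W - {c}))"
    by (rule is_tree_star) (use W in auto)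
  moreover have "insert c W - {c} = W" using W by auto
  ultimately have "Monomial (graph_monomial ?E) \<in> tree_ideal n m"
    using W c assms by (intro tree_ideal_generators(3)[of "insert c W"]) auto
  moreover have "block_star B =
      graph_monomial ?E + (\<Sum>k\<in>B - {c} - W. Poly_Mapping.single {c, k} 1)"
  proof -
    have "inj_on (\<lambda>k. {c, k}) W" using W by (auto simp: inj_on_def doubleton_eq_iff)
    then have "graph_monomial ?E = (\<Sum>k\<in>W. Poly_Mapping.single {c, k} 1)"
      by (simp add: graph_monomial_def sum.reindex)
    moreover have "block_star B = (\<Sum>k\<in>B - {c} - W. Poly_Mapping.single {c, k} 1) +
        (\<Sum>k\<in>W. Poly_Mapping.single {c, k} 1)"
      unfolding block_star_def star_def c_def[symmetric]
      by (rule sum.subset_diff) (use W fin in auto)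
    ultimately show ?thesis by (simp only: add.commute)
  qed
  moreover have "(\<Sum>k\<in>B - {c} - W. Poly_Mapping.single {c, k} 1) \<in> monomials n"
    using assms c by (intro sum_in_monomials) auto
  ultimately show ?thesis using tree_ideal_Monomial_add by simp
qed

lemma Monomial_in_tree_ideal:
  assumes "t \<in> monomials n"
    and "components n t \<notin> partitions n m \<or> expo_deg t + card (components n t) \<noteq> n"
  shows "Monomial t \<in> tree_ideal n m"
  using tree_ideal_or_cong_block_stars[OF assms(1), of m]
proof (elim disjE conjE)
  assume n: "n = card (components n t) + expo_deg t"
    and cong: "tree_cong n m t (\<Sum>B\<in>components n t. block_star B)"
  have P: "partition_on {1..n} (components n t)"
    using assms(1) by (rule partition_on_components)
  have sub: "C \<subseteq> {1..n}" "C \<noteq> {}" if "C \<in> components n t" for C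
    using that partition_onD1[OF P] partition_onD3[OF P] by auto
  obtain B where B: "B \<in> components n t" "m < card B"
    using assms(2) n P by (auto simp: partitions_def not_le)
  have "Monomial (block_star B + (\<Sum>C\<in>components n t - {B}. block_star C)) \<in> tree_ideal n m"
    using B sub block_star_in_tree_ideal
    by (intro tree_ideal_Monomial_add sum_in_monomials block_star_in_monomials) auto
  then have "Monomial (\<Sum>B\<in>components n t. block_star B) \<in> tree_ideal n m"
    using B by (simp add: sum.remove[of _ B])
  then show ?thesis using cong by (rule tree_cong_in_ideal[rotated])
qed

lemma tree_cong_same_components:
  assumes "t \<in> monomials n" "u \<in> monomials n" "components n t = components n u"
    and "expo_deg t + card (components n t) = n" "expo_deg u + card (components n u) = n"
  shows "tree_cong n m t u"
  using tree_ideal_or_cong_block_stars[OF assms(1), of m]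
    tree_ideal_or_cong_block_stars[OF assms(2), of m] assms(3-5)
  by (auto intro: tree_cong_trans tree_cong_sym)


section \<open>The tree ideal as a common kernel of functionals\<close>

text \<open>By \<open>components_degree_bound\<close> and \<open>acyclic_iff_card\<close>, the condition on the degree says that the
  monomial is square-free and that its graph is a forest; so this is the indicator of the
  forests with components \<^term>\<open>\<pi>\<close>.\<close>

definition forest_weight :: "nat \<Rightarrow> nat set set \<Rightarrow> expo \<Rightarrow> complex" where
  "forest_weight n \<pi> t = (if components n t = \<pi> \<and> expo_deg t + card \<pi> = n then 1 else 0)"

definition forest_coeff :: "nat \<Rightarrow> nat set set \<Rightarrow> mpoly \<Rightarrow> complex" where
  "forest_coeff n \<pi> = weighted_sum (forest_weight n \<pi>)"

lemma finite_partitions [simp]: "finite (partitions n m)"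
  using finitely_many_partition_on[of "{1..n}"]
  by (rule rev_finite_subset) (auto simp: partitions_def)

text \<open>Dropping one of the two factors leaves the components unchanged, and the bound on the degree
  already holds for the quotient.\<close>

lemma forest_weight_square:
  assumes "u \<in> monomials n" "S \<in> pairs n"
  shows "forest_weight n \<pi> (u + (Poly_Mapping.single S 1 + Poly_Mapping.single S 1)) = 0"
proof -
  let ?x = "Poly_Mapping.single S 1 :: expo"
  have "components n (u + (?x + ?x)) = components n (u + ?x)"
    by (simp add: components_def keys_add_expo)
  moreover have "n \<le> card (components n (u + ?x)) + expo_deg (u + ?x)"
    using assms by (intro components_degree_bound) simp
  ultimately show ?thesis
    by (auto simp: forest_weight_def expo_deg_add)
qed

text \<open>In a triangle, any two edges connect the same vertices as all three.\<close>

lemma conn_insert_rotate: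
  "conn (insert {i, j} (insert {j, k} E)) = conn (insert {i, k} (insert {j, k} E))"
proof -
  let ?F = "insert {i, j} (insert {i, k} (insert {j, k} E))"
  have "conn ?F = conn (insert {i, k} (insert {j, k} E))"
    by (rule conn_insert_redundant, rule conn_trans[of _ k])
       (auto intro: conn_edge conn_sym)
  moreover have "conn (insert {i, k} (insert {i, j} (insert {j, k} E))) =
      conn (insert {i, j} (insert {j, k} E))"
    by (rule conn_insert_redundant, rule conn_trans[of _ j])
       (auto intro: conn_edge)
  ultimately show ?thesis by (simp add: insert_commute)
qed

lemma forest_weight_rotate:
  "forest_weight n \<pi> (u + (Poly_Mapping.single {i, j} 1 + Poly_Mapping.single {j, k} 1)) =
   forest_weight n \<pi> (u + (Poly_Mapping.single {i, k} 1 + Poly_Mapping.single {j, k} 1))"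
  using conn_insert_rotate[of i j k "Poly_Mapping.keys u"]
  by (simp add: forest_weight_def expo_deg_add components_def comps_def keys_add_expo insert_commute)

lemma forest_weight_large_tree:
  assumes "u \<in> monomials n" "V \<subseteq> {1..n}" "card V = m + 1" "is_tree V E" "\<pi> \<in> partitions n m"
  shows "forest_weight n \<pi> (u + graph_monomial E) = 0"
proof -
  have t: "finite V" "V \<noteq> {}" "graph_on V E" "V \<times> V \<subseteq> conn E"
    using assms(4) by (auto simp: is_tree_iff)
  have "finite E" using t(1,3) by (rule graph_on_finite)
  obtain v where v: "v \<in> V" using t(2) by blast
  let ?F = "Poly_Mapping.keys (u + graph_monomial E)"
  let ?B = "conn ?F `` {v}"
  have "E \<subseteq> ?F" using \<open>finite E\<close> by (simp add: keys_add_expo)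
  then have "V \<subseteq> ?B" using t(4) v conn_mono[of E ?F] by auto
  have "E \<subseteq> pairs n"
    using t(3) assms(2) by (auto simp: graph_on_def pairs_def)
  then have mon: "u + graph_monomial E \<in> monomials n"
    using assms(1) by (simp add: graph_monomial_in_monomials)
  have B: "?B \<in> components n (u + graph_monomial E)"
    using v assms(2) by (auto simp: components_def comps_def)
  then have "finite ?B"
    using partition_onD1[OF partition_on_components[OF mon]] by (metis Union_upper finite_atLeastAtMost finite_subset)
  then have "m < card ?B" using card_mono[OF _ \<open>V \<subseteq> ?B\<close>] assms(3) by simp
  then have "components n (u + graph_monomial E) \<noteq> \<pi>"
    using B assms(5) by (auto simp: partitions_def not_le)
  then show ?thesis by (simp add: forest_weight_def)
qed

text \<open>The kernel of a functional need not be an ideal; the polynomials all of whose multiples lie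
  in the kernel form the largest ideal inside it.\<close>

lemma tree_ideal_forest_weight:
  assumes "f \<in> tree_ideal n m" "\<pi> \<in> partitions n m" "u \<in> monomials n"
  shows "weighted_sum (\<lambda>t. forest_weight n \<pi> (u + t)) f = 0"
proof -
  define K where "K = {f \<in> carrier (poly_ring n). \<forall>u\<in>monomials n. \<forall>\<pi>\<in>partitions n m.
    weighted_sum (\<lambda>t. forest_weight n \<pi> (u + t)) f = 0}"
  have "tree_ideal n m \<subseteq> K"
  proof (rule tree_ideal_minimal)
    show "ideal K (poly_ring n)"
    proof (rule poly_idealI)
      fix f g assume "f \<in> K" "g \<in> K"
      then show "f + g \<in> K"
        using Poly_Mapping.keys_add[of f g] by (auto simp: K_def weighted_sum_add)
    next
      fix f v c assume "f \<in> K" "v \<in> monomials n"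
      moreover from this have "Poly_Mapping.keys (Poly_Mapping.single v c * f) \<subseteq> monomials n"
        by (intro keys_mult_subset) (auto simp: K_def split: if_splits)
      ultimately show "Poly_Mapping.single v c * f \<in> K"
        by (simp add: K_def weighted_sum_single_mult add.assoc[symmetric])
    qed (auto simp: K_def)
  next
    fix S assume "S \<in> pairs n"
    then show "Var S ^ 2 \<in> K"
      by (simp add: K_def power2_eq_square Var_mult forest_weight_square)
  next
    fix i j k assume "{i, j, k} \<subseteq> {1..n}" "i \<noteq> j" "j \<noteq> k" "i \<noteq> k"
    then have "Var {i, j} * Var {j, k} - Var {i, k} * Var {j, k} \<in> carrier (poly_ring n)"
      using ideal.Icarr[OF tree_ideal_ideal tree_ideal_generators(2)] by blast
    then show "Var {i, j} * Var {j, k} - Var {i, k} * Var {j, k} \<in> K"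
      using forest_weight_rotate[of n _ _ i j k]
      by (simp add: K_def Var_mult weighted_sum_diff)
  next
    fix V and E :: "nat set set" assume V: "V \<subseteq> {1..n}" "card V = m + 1" "is_tree V E"
    then have "Monomial (graph_monomial E) \<in> carrier (poly_ring n)"
      using ideal.Icarr[OF tree_ideal_ideal tree_ideal_generators(3)] by blast
    then show "Monomial (graph_monomial E) \<in> K"
      using V forest_weight_large_tree by (simp add: K_def)
  qed
  then show ?thesis using assms by (auto simp: K_def)
qed

lemma tree_ideal_forest_coeff:
  assumes "f \<in> tree_ideal n m" "\<pi> \<in> partitions n m"
  shows "forest_coeff n \<pi> f = 0"
  using tree_ideal_forest_weight[OF assms, of 0] by (simp add: forest_coeff_def)

text \<open>A spanning tree of a block \<open>B\<close> has \<open>|B| - 1\<close> edges, and no edge leaves its block.\<close>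

lemma forest_monomial:
  assumes P: "partition_on {1..n} \<pi>" and T: "\<And>B. B \<in> \<pi> \<Longrightarrow> is_tree B (T B)"
  defines "t \<equiv> \<Sum>B\<in>\<pi>. graph_monomial (T B)"
  shows "t \<in> monomials n" "components n t = \<pi>" "expo_deg t + card \<pi> = n"
proof -
  have tree: "finite B" "graph_on B (T B)" "B \<times> B \<subseteq> conn (T B)" "finite (T B)"
    "Suc (card (T B)) = card B" if "B \<in> \<pi>" for B
    using T[OF that] is_tree_card[OF T[OF that]] graph_on_finite[of B "T B"]
    by (auto simp: is_tree_iff)
  have fin: "finite \<pi>" using P by (rule finite_elements[rotated]) simp
  have sub: "B \<subseteq> {1..n}" if "B \<in> \<pi>" for B using that partition_onD1[OF P] by auto
  have pairs: "T B \<subseteq> pairs n" if "B \<in> \<pi>" for B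
    using tree(2)[OF that] sub[OF that] by (auto simp: graph_on_def pairs_def)
  show mon: "t \<in> monomials n"
    unfolding t_def using pairs by (intro sum_in_monomials graph_monomial_in_monomials)
  have keys: "Poly_Mapping.keys t = (\<Union>B\<in>\<pi>. T B)"
  proof -
    have "Poly_Mapping.keys (\<Sum>B\<in>Q. graph_monomial (T B)) = (\<Union>B\<in>Q. T B)" if "Q \<subseteq> \<pi>" for Q
      using finite_subset[OF that fin] that by induction (auto simp: keys_add_expo tree(4))
    then show ?thesis by (simp add: t_def)
  qed
  show "components n t = \<pi>"
    unfolding components_def
  proof (rule comps_eqI[OF _ P])
    show "graph_on {1..n} (Poly_Mapping.keys t)"
      unfolding graph_on_iff_pairs using mon by (simp add: monomials_def)
    show "\<exists>B\<in>\<pi>. e \<subseteq> B" if "e \<in> Poly_Mapping.keys t" for e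
      using that tree(2) unfolding keys graph_on_def by blast
    show "B \<times> B \<subseteq> conn (Poly_Mapping.keys t)" if "B \<in> \<pi>" for B
    proof -
      have "T B \<subseteq> Poly_Mapping.keys t" using that keys by auto
      then show ?thesis using tree(3)[OF that] conn_mono by blast
    qed
  qed
  have "expo_deg t + card \<pi> = (\<Sum>B\<in>\<pi>. card (T B) + 1)"
    by (simp only: t_def expo_deg_sum expo_deg_graph_monomial sum.distrib card_eq_sum)
  also have "\<dots> = (\<Sum>B\<in>\<pi>. card B)"
    by (intro sum.cong) (use tree(5) in \<open>auto simp: Suc_eq_plus1\<close>)
  also have "\<dots> = card {1..n}"
    using card_Union_disjoint[of \<pi>] tree(1) partition_onD1[OF P] partition_onD2[OF P] by simp
  finally show "expo_deg t + card \<pi> = n" by simp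
qed

text \<open>One forest for each partition. The description of the tree ideal needs any such choice, which
  stars provide; the standard monomials are the choice that is minimal for the monomial order.\<close>

locale forest_representatives =
  fixes n m :: nat and M :: "nat set set \<Rightarrow> expo"
  assumes M_monomial: "\<And>\<pi>. \<pi> \<in> partitions n m \<Longrightarrow> M \<pi> \<in> monomials n"
    and M_components: "\<And>\<pi>. \<pi> \<in> partitions n m \<Longrightarrow> components n (M \<pi>) = \<pi>"
    and M_degree: "\<And>\<pi>. \<pi> \<in> partitions n m \<Longrightarrow> expo_deg (M \<pi>) + card \<pi> = n"
begin

lemma forest_coeff_combination:
  assumes "\<sigma> \<in> partitions n m"
  shows "forest_coeff n \<sigma> (\<Sum>\<pi>\<in>partitions n m. Const (c \<pi>) * Monomial (M \<pi>)) = c \<sigma>"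
proof -
  have "forest_coeff n \<sigma> (\<Sum>\<pi>\<in>partitions n m. Const (c \<pi>) * Monomial (M \<pi>)) =
      (\<Sum>\<pi>\<in>partitions n m. c \<pi> * forest_weight n \<sigma> (M \<pi>))"
    by (simp add: forest_coeff_def weighted_sum_sum Const_mult_Monomial)
  also have "\<dots> = (\<Sum>\<pi>\<in>partitions n m. if \<pi> = \<sigma> then c \<sigma> else 0)"
    by (intro sum.cong) (auto simp: forest_weight_def M_components M_degree)
  finally show ?thesis using assms by simp
qed

definition normal_form :: "mpoly \<Rightarrow> mpoly" where
  "normal_form f = (\<Sum>\<pi>\<in>partitions n m. Const (forest_coeff n \<pi> f) * Monomial (M \<pi>))"

lemma normal_form_sum: "normal_form (sum f A) = (\<Sum>a\<in>A. normal_form (f a))"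
proof -
  have add: "normal_form (f + g) = normal_form f + normal_form g" for f g
    by (simp add: normal_form_def forest_coeff_def weighted_sum_add Const_mult_Monomial
        single_add sum.distrib)
  have "normal_form 0 = 0"
    by (simp add: normal_form_def forest_coeff_def Const_mult_Monomial)
  then show ?thesis
    by (induction A rule: infinite_finite_induct) (simp_all add: add)
qed

lemma single_diff_normal_form:
  assumes "t \<in> monomials n"
  shows "Poly_Mapping.single t c - normal_form (Poly_Mapping.single t c) \<in> tree_ideal n m"
proof (cases "components n t \<in> partitions n m \<and> expo_deg t + card (components n t) = n")
  case True
  define \<sigma> where "\<sigma> = components n t"
  have \<sigma>: "\<sigma> \<in> partitions n m" using True by (simp add: \<sigma>_def)
  have "normal_form (Poly_Mapping.single t c) =
      (\<Sum>\<pi>\<in>partitions n m. if \<pi> = \<sigma> then Poly_Mapping.single (M \<sigma>) c else 0)"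
    unfolding normal_form_def
    by (intro sum.cong)
       (use True in \<open>auto simp: forest_coeff_def forest_weight_def Const_mult_Monomial \<sigma>_def\<close>)
  then have "normal_form (Poly_Mapping.single t c) = Poly_Mapping.single (M \<sigma>) c"
    using \<sigma> by simp
  then have eq: "Poly_Mapping.single t c - normal_form (Poly_Mapping.single t c) =
      Const c * (Monomial t - Monomial (M \<sigma>))"
    by (simp add: right_diff_distrib Const_mult_Monomial)
  have "tree_cong n m t (M \<sigma>)"
    by (rule tree_cong_same_components)
       (use True assms \<sigma> in \<open>simp_all add: M_monomial M_components M_degree \<sigma>_def\<close>)
  then show ?thesis
    unfolding eq tree_cong_def
    by (rule poly_ideal_mult[OF tree_ideal_ideal]) (simp add: Const_def)
next
  case False
  then have "Monomial t \<in> tree_ideal n m" using assms by (intro Monomial_in_tree_ideal) auto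
  then have "Const c * Monomial t \<in> tree_ideal n m"
    by (rule poly_ideal_mult[OF tree_ideal_ideal]) (simp add: Const_def)
  moreover have "normal_form (Poly_Mapping.single t c) = 0"
    unfolding normal_form_def
    by (intro sum.neutral)
       (use False in \<open>auto simp: forest_coeff_def forest_weight_def Const_mult_Monomial\<close>)
  ultimately show ?thesis by (simp add: Const_mult_Monomial)
qed

lemma diff_normal_form:
  assumes "Poly_Mapping.keys f \<subseteq> monomials n"
  shows "f - normal_form f \<in> tree_ideal n m"
proof -
  let ?s = "\<lambda>t. Poly_Mapping.single t (Poly_Mapping.lookup f t)"
  have "(\<Sum>t\<in>Poly_Mapping.keys f. ?s t - normal_form (?s t)) \<in> tree_ideal n m"
    using assms by (intro poly_ideal_sum[OF tree_ideal_ideal] single_diff_normal_form) auto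
  then show ?thesis
    by (simp add: sum_subtractf normal_form_sum[symmetric] sum_singles)
qed

lemma descends_to_basis_tree_ideal:
  "descends_to_basis n (tree_ideal n m) (partitions n m) (\<lambda>\<pi>. Monomial (M \<pi>))"
  unfolding descends_to_basis_def
proof (intro conjI ballI)
  show "(\<lambda>\<pi>. Monomial (M \<pi>)) ` partitions n m \<subseteq> carrier (poly_ring n)"
    using M_monomial by auto
  fix f assume f: "f \<in> carrier (poly_ring n)"
  have comb: "Poly_Mapping.keys (\<Sum>\<pi>\<in>partitions n m. Const (c \<pi>) * Monomial (M \<pi>)) \<subseteq> monomials n" for c
    by (rule keys_sum_subset) (auto simp: Const_mult_Monomial M_monomial split: if_splits)
  have coset: "tree_ideal n m +>\<^bsub>poly_ring n\<^esub> f =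
      tree_ideal n m +>\<^bsub>poly_ring n\<^esub> (\<Sum>\<pi>\<in>partitions n m. Const (c \<pi>) * Monomial (M \<pi>)) \<longleftrightarrow>
      f - (\<Sum>\<pi>\<in>partitions n m. Const (c \<pi>) * Monomial (M \<pi>)) \<in> tree_ideal n m" for c
    using f comb by (intro poly_ideal_coset_eq_iff[OF tree_ideal_ideal]) auto
  show "\<exists>!c. c \<in> partitions n m \<rightarrow>\<^sub>E UNIV \<and> tree_ideal n m +>\<^bsub>poly_ring n\<^esub> f =
      tree_ideal n m +>\<^bsub>poly_ring n\<^esub> (\<Sum>\<pi>\<in>partitions n m. Const (c \<pi>) * Monomial (M \<pi>))"
    unfolding coset
  proof (rule ex1I[of _ "\<lambda>\<pi>\<in>partitions n m. forest_coeff n \<pi> f"])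
    show "(\<lambda>\<pi>\<in>partitions n m. forest_coeff n \<pi> f) \<in> partitions n m \<rightarrow>\<^sub>E UNIV \<and>
        f - (\<Sum>\<pi>\<in>partitions n m. Const ((\<lambda>\<pi>\<in>partitions n m. forest_coeff n \<pi> f) \<pi>) * Monomial (M \<pi>))
          \<in> tree_ideal n m"
      using diff_normal_form[of f] f by (simp add: normal_form_def)
  next
    fix c assume c: "c \<in> partitions n m \<rightarrow>\<^sub>E (UNIV :: complex set) \<and>
      f - (\<Sum>\<pi>\<in>partitions n m. Const (c \<pi>) * Monomial (M \<pi>)) \<in> tree_ideal n m"
    have "c \<sigma> = forest_coeff n \<sigma> f" if "\<sigma> \<in> partitions n m" for \<sigma>
      using tree_ideal_forest_coeff[OF conjunct2[OF c] that] forest_coeff_combination[OF that, of c]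
      by (simp add: forest_coeff_def weighted_sum_diff)
    then show "c = (\<lambda>\<pi>\<in>partitions n m. forest_coeff n \<pi> f)"
      using c by (intro extensionalityI[of _ "partitions n m"]) (auto simp: PiE_def)
  qed
qed simp

end

text \<open>A polynomial on which all functionals vanish has normal form 0.\<close>

lemma tree_ideal_eq_kernel:
  "tree_ideal n m =
     {f \<in> carrier (poly_ring n). \<forall>\<pi>\<in>partitions n m. forest_coeff n \<pi> f = 0}"
proof (intro equalityI subsetI)
  fix f assume "f \<in> tree_ideal n m"
  then show "f \<in> {f \<in> carrier (poly_ring n). \<forall>\<pi>\<in>partitions n m. forest_coeff n \<pi> f = 0}"
    using tree_ideal_forest_coeff poly_ideal_subset[OF tree_ideal_ideal] by auto
next
  fix f assume f: "f \<in> {f \<in> carrier (poly_ring n). \<forall>\<pi>\<in>partitions n m. forest_coeff n \<pi> f = 0}"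
  define T :: "nat set \<Rightarrow> nat set set" where "T B = (\<lambda>k. {Min B, k}) ` (B - {Min B})" for B
  interpret forest_representatives n m "\<lambda>\<pi>. \<Sum>B\<in>\<pi>. graph_monomial (T B)"
  proof unfold_locales
    fix \<pi> assume "\<pi> \<in> partitions n m"
    then have P: "partition_on {1..n} \<pi>" by (simp add: partitions_def)
    have T: "is_tree B (T B)" if "B \<in> \<pi>" for B
    proof -
      have "B \<subseteq> {1..n}" "B \<noteq> {}" using that partition_onD1[OF P] partition_onD3[OF P] by auto
      then have "finite B" by (auto dest: finite_subset)
      then show ?thesis unfolding T_def using \<open>B \<noteq> {}\<close> by (intro is_tree_star Min_in)
    qed
    show "(\<Sum>B\<in>\<pi>. graph_monomial (T B)) \<in> monomials n"
      "components n (\<Sum>B\<in>\<pi>. graph_monomial (T B)) = \<pi>"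
      "expo_deg (\<Sum>B\<in>\<pi>. graph_monomial (T B)) + card \<pi> = n"
      using forest_monomial[OF P T] by auto
  qed
  have "normal_form f = 0" using f by (simp add: normal_form_def Const_def)
  then show "f \<in> tree_ideal n m" using diff_normal_form[of f] f by simp
qed


section \<open>The associated graded ideal of the partition points\<close>

text \<open>The coordinates that are 1 at the point of \<^term>\<open>\<pi>\<close>.\<close>

definition block_pairs :: "nat \<Rightarrow> nat set set \<Rightarrow> nat set set" where
  "block_pairs n \<pi> = {S \<in> pairs n. \<exists>B\<in>\<pi>. S \<subseteq> B}"

lemma finite_block_pairs [simp]: "finite (block_pairs n \<pi>)"
  by (simp add: block_pairs_def)

lemma poly_eval_partition_point:
  assumes "Poly_Mapping.keys f \<subseteq> monomials n"
  shows "poly_eval (partition_point n \<pi>) f =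
    weighted_sum (\<lambda>t. if Poly_Mapping.keys t \<subseteq> block_pairs n \<pi> then 1 else 0) f"
  unfolding poly_eval_def weighted_sum_def
proof (rule sum.cong[OF refl], rule arg_cong[of _ _ "(*) _"])
  fix t assume "t \<in> Poly_Mapping.keys f"
  then have sub: "Poly_Mapping.keys t \<subseteq> pairs n" using assms by (auto simp: monomials_def)
  have "(\<Prod>S\<in>Poly_Mapping.keys t. partition_point n \<pi> S ^ Poly_Mapping.lookup t S) =
      (\<Prod>S\<in>Poly_Mapping.keys t. if S \<in> block_pairs n \<pi> then 1 else 0)"
  proof (rule prod.cong[OF refl])
    fix S assume "S \<in> Poly_Mapping.keys t"
    then have "S \<in> pairs n" "Poly_Mapping.lookup t S \<noteq> 0" using sub by (auto simp: in_keys_iff)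
    then show "partition_point n \<pi> S ^ Poly_Mapping.lookup t S =
        (if S \<in> block_pairs n \<pi> then 1 else 0)"
      by (simp add: partition_point_def block_pairs_def)
  qed
  also have "\<dots> = (if Poly_Mapping.keys t \<subseteq> block_pairs n \<pi> then 1 else 0)"
    by (auto simp: prod_zero_iff intro!: prod.neutral)
  finally show "(\<Prod>S\<in>Poly_Mapping.keys t. partition_point n \<pi> S ^ Poly_Mapping.lookup t S) =
      (if Poly_Mapping.keys t \<subseteq> block_pairs n \<pi> then 1 else 0)" .
qed

lemma vanishing_ideal_partition_points:
  "vanishing_ideal n (partition_points n m) = {f \<in> carrier (poly_ring n). \<forall>\<pi>\<in>partitions n m.
     weighted_sum (\<lambda>t. if Poly_Mapping.keys t \<subseteq> block_pairs n \<pi> then 1 else 0) f = 0}"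
  by (auto simp: vanishing_ideal_def partition_points_def poly_eval_partition_point)

lemma lookup_top_component:
  "Poly_Mapping.lookup (top_component f) t =
    (if t \<in> Poly_Mapping.keys f \<and> expo_deg t = Max (expo_deg ` Poly_Mapping.keys f)
     then Poly_Mapping.lookup f t else 0)"
  by (auto simp: top_component_def lookup_sum lookup_single when_def)

lemma keys_top_component:
  "Poly_Mapping.keys (top_component f) =
    {t \<in> Poly_Mapping.keys f. expo_deg t = Max (expo_deg ` Poly_Mapping.keys f)}"
  by (auto simp: in_keys_iff lookup_top_component split: if_splits)

lemma top_component_eqI:
  assumes "g \<noteq> 0" and g: "\<And>t. t \<in> Poly_Mapping.keys g \<Longrightarrow> expo_deg t = d"
    and h: "\<And>t. t \<in> Poly_Mapping.keys h \<Longrightarrow> expo_deg t < d"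
  shows "top_component (g + h) = g"
proof -
  have lookup_h: "Poly_Mapping.lookup h t = 0" if "expo_deg t = d" for t
    using h[of t] that by (auto simp: in_keys_iff)
  have lookup_g: "Poly_Mapping.lookup g t = 0" if "expo_deg t \<noteq> d" for t
    using g[of t] that by (auto simp: in_keys_iff)
  obtain s where s: "s \<in> Poly_Mapping.keys g" using \<open>g \<noteq> 0\<close> by fastforce
  have "Max (expo_deg ` Poly_Mapping.keys (g + h)) = d"
  proof (rule Max_eqI)
    fix e assume "e \<in> expo_deg ` Poly_Mapping.keys (g + h)"
    then show "e \<le> d" using Poly_Mapping.keys_add[of g h] g h by (auto simp: less_imp_le)
  next
    have "s \<in> Poly_Mapping.keys (g + h)"
      using s lookup_h g[OF s] by (simp add: in_keys_iff lookup_add)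
    then show "d \<in> expo_deg ` Poly_Mapping.keys (g + h)" using g[OF s] by auto
  qed simp
  then have "Poly_Mapping.lookup (top_component (g + h)) t = Poly_Mapping.lookup g t" for t
    by (cases "expo_deg t = d")
       (simp_all add: lookup_top_component lookup_add in_keys_iff lookup_g lookup_h)
  then show ?thesis by (rule poly_mapping_eqI)
qed

lemma gr_ideal_generators_subset:
  "{top_component f |f. f \<in> vanishing_ideal n Z \<and> f \<noteq> 0} \<subseteq> carrier (poly_ring n)"
  by (auto simp: vanishing_ideal_def keys_top_component)

lemma gr_ideal_ideal: "ideal (gr_ideal n Z) (poly_ring n)"
  unfolding gr_ideal_def
  by (rule ring.genideal_ideal[OF poly_ring_is_ring gr_ideal_generators_subset])

lemma gr_ideal_mem:
  assumes "g + h \<in> vanishing_ideal n Z"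
    and "\<And>t. t \<in> Poly_Mapping.keys g \<Longrightarrow> expo_deg t = d"
    and "\<And>t. t \<in> Poly_Mapping.keys h \<Longrightarrow> expo_deg t < d"
  shows "g \<in> gr_ideal n Z"
proof (cases "g = 0")
  case True
  then show ?thesis using poly_ideal_0[OF gr_ideal_ideal] by simp
next
  case False
  then have top: "top_component (g + h) = g" by (rule top_component_eqI) (use assms in auto)
  then have "g + h \<noteq> 0" using False by (auto simp: top_component_def)
  then have "g \<in> {top_component f |f. f \<in> vanishing_ideal n Z \<and> f \<noteq> 0}"
    using assms(1) top by force
  then show ?thesis
    unfolding gr_ideal_def
    using ring.genideal_self[OF poly_ring_is_ring gr_ideal_generators_subset] by blast
qed

lemma block_pairs_trans:
  assumes "partition_on {1..n} \<pi>" "{i, j, k} \<subseteq> {1..n}" "i \<noteq> k"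
    "{i, j} \<in> block_pairs n \<pi>" "{j, k} \<in> block_pairs n \<pi>"
  shows "{i, k} \<in> block_pairs n \<pi>"
proof -
  obtain B C where BC: "B \<in> \<pi>" "{i, j} \<subseteq> B" "C \<in> \<pi>" "{j, k} \<subseteq> C"
    using assms(4,5) by (auto simp: block_pairs_def)
  then have "B = C" using partition_on_same_block[OF assms(1)] by blast
  then show ?thesis using BC assms(2,3) by (auto simp: block_pairs_def)
qed

lemma tree_not_subset_block_pairs:
  assumes "\<pi> \<in> partitions n m" "V \<subseteq> {1..n}" "card V = m + 1" "is_tree V E"
  shows "\<not> E \<subseteq> block_pairs n \<pi>"
proof
  assume E: "E \<subseteq> block_pairs n \<pi>"
  have t: "V \<noteq> {}" "V \<times> V \<subseteq> conn E" using assms(4) by (auto simp: is_tree_iff)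
  obtain v where v: "v \<in> V" using t(1) by blast
  have P: "partition_on {1..n} \<pi>" using assms(1) by (simp add: partitions_def)
  have "conn E `` {v} \<in> comps {1..n} E" using v assms(2) by (auto simp: comps_def)
  moreover have "\<exists>B\<in>\<pi>. e \<subseteq> B" if "e \<in> E" for e
    using E that by (auto simp: block_pairs_def)
  ultimately obtain B where B: "B \<in> \<pi>" "conn E `` {v} \<subseteq> B"
    using comps_subset_block[OF P, of E] by metis
  then have "V \<subseteq> B" using t(2) v by auto
  moreover have "B \<subseteq> {1..n}" using B(1) partition_onD1[OF P] by auto
  then have "finite B" by (rule finite_subset) simp
  ultimately have "m + 1 \<le> card B" using assms(3) card_mono by metis
  then show False using B(1) assms(1) by (auto simp: partitions_def)
qed

text \<open>The square of a variable is the top component of \<open>x\<^sub>S\<^sup>2 - x\<^sub>S\<close>, which vanishes because the coordinates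
  are 0 or 1. The other generators are homogeneous and vanish themselves: being in the same
  block is transitive, and no block has room for a tree with \<open>m + 1\<close> vertices.\<close>

lemma tree_ideal_subset_gr_ideal:
  "tree_ideal n m \<subseteq> gr_ideal n (partition_points n m)"
proof (rule tree_ideal_minimal[OF gr_ideal_ideal])
  fix S assume S: "S \<in> pairs n"
  have "Var S ^ 2 - Var S \<in> vanishing_ideal n (partition_points n m)"
    unfolding vanishing_ideal_partition_points power2_eq_square Var_mult
    using S keys_diff_subset[of _ "monomials n"]
    by (auto simp: Var_def weighted_sum_diff keys_add_expo)
  then have "Var S ^ 2 + - Var S \<in> vanishing_ideal n (partition_points n m)" by simp
  then show "Var S ^ 2 \<in> gr_ideal n (partition_points n m)"
    by (rule gr_ideal_mem[where d = 2], unfold power2_eq_square Var_mult)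
       (auto simp: expo_deg_add Var_def)
next
  fix i j k assume ijk: "{i, j, k} \<subseteq> {1..n}" "i \<noteq> j" "j \<noteq> k" "i \<noteq> k"
  let ?f = "Var {i, j} * Var {j, k} - Var {i, k} * Var {j, k}"
  have "?f \<in> carrier (poly_ring n)"
    using ideal.Icarr[OF tree_ideal_ideal tree_ideal_generators(2)[OF ijk]] .
  moreover have "Poly_Mapping.keys (Poly_Mapping.single {i, j} 1 + Poly_Mapping.single {j, k} 1 :: expo)
        \<subseteq> block_pairs n \<pi> \<longleftrightarrow>
      Poly_Mapping.keys (Poly_Mapping.single {i, k} 1 + Poly_Mapping.single {j, k} 1 :: expo)
        \<subseteq> block_pairs n \<pi>" if "\<pi> \<in> partitions n m" for \<pi>
  proof -
    have P: "partition_on {1..n} \<pi>" using that by (simp add: partitions_def)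
    have "{i, k, j} \<subseteq> {1..n}" using ijk by simp
    then have "{i, j} \<in> block_pairs n \<pi> \<and> {j, k} \<in> block_pairs n \<pi> \<longleftrightarrow>
        {i, k} \<in> block_pairs n \<pi> \<and> {j, k} \<in> block_pairs n \<pi>"
      using block_pairs_trans[OF P ijk(1) ijk(4)] block_pairs_trans[OF P _ ijk(2), of k]
      unfolding insert_commute[of k j] by blast
    then show ?thesis by (auto simp: keys_add_expo)
  qed
  ultimately have "?f + 0 \<in> vanishing_ideal n (partition_points n m)"
    by (simp add: vanishing_ideal_partition_points Var_mult weighted_sum_diff)
  moreover have "Poly_Mapping.keys ?f \<subseteq> {t. expo_deg t = 2}"
    unfolding Var_mult by (rule keys_diff_subset) (auto simp: expo_deg_add)
  ultimately show "?f \<in> gr_ideal n (partition_points n m)"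
    by (intro gr_ideal_mem[of ?f 0 _ _ 2]) auto
next
  fix V and E :: "nat set set" assume V: "V \<subseteq> {1..n}" "card V = m + 1" "is_tree V E"
  have "E \<subseteq> pairs n" "finite E"
    using V(1,3) graph_on_finite[of V E] by (auto simp: is_tree_iff graph_on_def pairs_def)
  then have "Monomial (graph_monomial E) + 0 \<in> vanishing_ideal n (partition_points n m)"
    using tree_not_subset_block_pairs[OF _ V]
    by (simp add: vanishing_ideal_partition_points graph_monomial_in_monomials)
  then show "Monomial (graph_monomial E) \<in> gr_ideal n (partition_points n m)"
    by (rule gr_ideal_mem[where d = "expo_deg (graph_monomial E)"]) auto
qed

lemma block_pairs_mono_imp_refines:
  assumes "partition_on {1..n} \<pi>" "partition_on {1..n} \<sigma>" "block_pairs n \<pi> \<subseteq> block_pairs n \<sigma>"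
  shows "refines {1..n} \<pi> \<sigma>"
  unfolding refines_def
proof (intro conjI ballI assms(1,2))
  fix B assume B: "B \<in> \<pi>"
  then have sub: "B \<subseteq> {1..n}" "B \<noteq> {}"
    using partition_onD1[OF assms(1)] partition_onD3[OF assms(1)] by auto
  then obtain x C where x: "x \<in> B" "x \<in> C" "C \<in> \<sigma>" using partition_onD1[OF assms(2)] by blast
  have "y \<in> C" if "y \<in> B" for y
  proof (cases "y = x")
    case False
    then have "{x, y} \<in> block_pairs n \<pi>"
      using B x sub that by (auto simp: block_pairs_def)
    then have "{x, y} \<in> block_pairs n \<sigma>" using assms(3) by blast
    then obtain D where "D \<in> \<sigma>" "{x, y} \<subseteq> D" unfolding block_pairs_def by blast
    then show ?thesis using partition_on_same_block[OF assms(2), of C D x] x by auto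
  qed (use x in simp)
  then show "\<exists>C\<in>\<sigma>. B \<subseteq> C" using x by blast
qed

lemma components_within_partition:
  assumes "t \<in> monomials n" "\<sigma> \<in> partitions n m" "Poly_Mapping.keys t \<subseteq> block_pairs n \<sigma>"
  shows "components n t \<in> partitions n m" "block_pairs n (components n t) \<subseteq> block_pairs n \<sigma>"
proof -
  have P: "partition_on {1..n} \<sigma>" and m: "\<And>B. B \<in> \<sigma> \<Longrightarrow> card B \<le> m"
    using assms(2) by (auto simp: partitions_def)
  have sub: "\<exists>B\<in>\<sigma>. C \<subseteq> B" if "C \<in> components n t" for C
    using comps_subset_block[OF P, of "Poly_Mapping.keys t" C] assms(3) that
    by (auto simp: components_def block_pairs_def)
  show "block_pairs n (components n t) \<subseteq> block_pairs n \<sigma>"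
  proof
    fix S assume "S \<in> block_pairs n (components n t)"
    then obtain C where "S \<in> pairs n" "C \<in> components n t" "S \<subseteq> C"
      unfolding block_pairs_def by blast
    then show "S \<in> block_pairs n \<sigma>"
      using sub[of C] unfolding block_pairs_def by blast
  qed
  have "card C \<le> m" if C: "C \<in> components n t" for C
  proof -
    obtain B where B: "B \<in> \<sigma>" "C \<subseteq> B" using sub[OF C] by blast
    have "B \<subseteq> {1..n}" using B(1) partition_onD1[OF P] by auto
    then have "finite B" by (rule finite_subset) simp
    then show ?thesis using card_mono[OF _ B(2)] m[OF B(1)] by simp
  qed
  then show "components n t \<in> partitions n m"
    using partition_on_components[OF assms(1)] by (auto simp: partitions_def)
qed

lemma keys_subset_block_pairs_components:
  "t \<in> monomials n \<Longrightarrow> Poly_Mapping.keys t \<subseteq> block_pairs n (components n t)"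
  using edge_in_comp[of "{1..n}" "Poly_Mapping.keys t"]
  by (auto simp: block_pairs_def components_def graph_on_iff_pairs monomials_def)

text \<open>At the point of \<^term>\<open>\<sigma>\<close> a monomial takes the value 1 if its components refine
  \<^term>\<open>\<sigma>\<close> and 0 otherwise, so the matrix of values is that of the refinement order, which is
  unitriangular.\<close>

lemma vanishing_component_sum:
  assumes f: "f \<in> vanishing_ideal n (partition_points n m)" and "\<sigma> \<in> partitions n m"
  shows "weighted_sum (\<lambda>t. if components n t = \<sigma> then 1 else 0) f = 0"
  using assms(2)
proof (induction "card (block_pairs n \<sigma>)" arbitrary: \<sigma> rule: less_induct)
  case less
  let ?P = "{\<rho> \<in> partitions n m. block_pairs n \<rho> \<subseteq> block_pairs n \<sigma>}"
  let ?a = "\<lambda>\<rho>. weighted_sum (\<lambda>t. if components n t = \<rho> then 1 else 0) f"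
  have keys: "t \<in> monomials n" if "t \<in> Poly_Mapping.keys f" for t
    using f that by (auto simp: vanishing_ideal_def)
  have fin: "finite ?P" by simp
  have "0 = weighted_sum (\<lambda>t. if Poly_Mapping.keys t \<subseteq> block_pairs n \<sigma> then 1 else 0) f"
    using f less.prems by (simp add: vanishing_ideal_partition_points)
  also have "\<dots> = weighted_sum (\<lambda>t. \<Sum>\<rho>\<in>?P. if components n t = \<rho> then 1 else 0) f"
  proof (rule weighted_sum_cong)
    fix t assume "t \<in> Poly_Mapping.keys f"
    then have t: "t \<in> monomials n" by (rule keys)
    have "Poly_Mapping.keys t \<subseteq> block_pairs n \<sigma> \<longleftrightarrow> components n t \<in> ?P"
      using components_within_partition[OF t less.prems] keys_subset_block_pairs_components[OF t]
      by blast
    then show "(if Poly_Mapping.keys t \<subseteq> block_pairs n \<sigma> then 1 else 0 :: complex) =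
        (\<Sum>\<rho>\<in>?P. if components n t = \<rho> then 1 else 0)"
      using fin by simp
  qed
  also have "\<dots> = (\<Sum>\<rho>\<in>?P. ?a \<rho>)" by (rule weighted_sum_sum_weights)
  also have "\<dots> = (\<Sum>\<rho>\<in>?P. if \<rho> = \<sigma> then ?a \<sigma> else 0)"
  proof (rule sum.cong[OF refl])
    fix \<rho> assume \<rho>: "\<rho> \<in> ?P"
    show "?a \<rho> = (if \<rho> = \<sigma> then ?a \<sigma> else 0)"
    proof (cases "\<rho> = \<sigma>")
      case False
      have "block_pairs n \<rho> \<noteq> block_pairs n \<sigma>"
      proof
        assume "block_pairs n \<rho> = block_pairs n \<sigma>"
        then have "\<rho> = \<sigma>"
          using \<rho> less.prems block_pairs_mono_imp_refines[of n \<rho> \<sigma>]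
            block_pairs_mono_imp_refines[of n \<sigma> \<rho>]
          by (intro refines_asym[of "{1..n}"]) (auto simp: partitions_def)
        then show False using False by simp
      qed
      then have "card (block_pairs n \<rho>) < card (block_pairs n \<sigma>)"
        using \<rho> by (intro psubset_card_mono) auto
      then show ?thesis using less.hyps[of \<rho>] \<rho> False by simp
    qed simp
  qed
  also have "\<dots> = ?a \<sigma>" using fin less.prems by simp
  finally show ?case by simp
qed

lemma weighted_sum_top_component:
  "weighted_sum w (top_component f) =
    weighted_sum (\<lambda>t. if expo_deg t = Max (expo_deg ` Poly_Mapping.keys f) then w t else 0) f"
  unfolding weighted_sum_def[of _ f]
  by (subst weighted_sum_superset[of "Poly_Mapping.keys f"])
     (auto simp: keys_top_component lookup_top_component intro!: sum.cong)

text \<open>The functional of \<^term>\<open>\<pi>\<close> sees only the degree \<open>n - |\<pi>|\<close>, the least one that a monomial with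
  components \<^term>\<open>\<pi>\<close> can have. If this is the top degree of \<^term>\<open>f\<close>, then all monomials of
  \<^term>\<open>f\<close> with these components have it, and the functional is the sum that vanishes by
  \<open>vanishing_component_sum\<close>.\<close>

lemma top_component_in_tree_ideal:
  assumes f: "f \<in> vanishing_ideal n (partition_points n m)"
  shows "top_component f \<in> tree_ideal n m"
proof -
  let ?d = "Max (expo_deg ` Poly_Mapping.keys f)"
  have keys: "Poly_Mapping.keys f \<subseteq> monomials n" using f by (auto simp: vanishing_ideal_def)
  have "forest_coeff n \<pi> (top_component f) = 0" if \<pi>: "\<pi> \<in> partitions n m" for \<pi>
  proof (cases "?d + card \<pi> = n")
    case True
    have "forest_coeff n \<pi> (top_component f) =
        weighted_sum (\<lambda>t. if components n t = \<pi> then 1 else 0) f"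
      unfolding forest_coeff_def weighted_sum_top_component
    proof (rule weighted_sum_cong)
      fix t assume t: "t \<in> Poly_Mapping.keys f"
      have "n \<le> card (components n t) + expo_deg t"
        using t keys by (intro components_degree_bound) auto
      moreover have "expo_deg t \<le> ?d" using t by (intro Max_ge) auto
      ultimately show "(if expo_deg t = ?d then forest_weight n \<pi> t else 0) =
          (if components n t = \<pi> then 1 else 0)"
        using True by (auto simp: forest_weight_def)
    qed
    then show ?thesis using vanishing_component_sum[OF f \<pi>] by simp
  next
    case False
    have "forest_coeff n \<pi> (top_component f) = weighted_sum (\<lambda>t. 0) f"
      unfolding forest_coeff_def weighted_sum_top_component
      by (rule weighted_sum_cong) (use False in \<open>auto simp: forest_weight_def\<close>)
    then show ?thesis by (simp add: weighted_sum_def)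
  qed
  then show ?thesis
    unfolding tree_ideal_eq_kernel using keys by (auto simp: keys_top_component)
qed

lemma gr_ideal_eq_tree_ideal: "gr_ideal n (partition_points n m) = tree_ideal n m"
proof
  show "gr_ideal n (partition_points n m) \<subseteq> tree_ideal n m"
    unfolding gr_ideal_def
    by (rule ring.genideal_minimal[OF poly_ring_is_ring tree_ideal_ideal])
       (use top_component_in_tree_ideal in auto)
qed (rule tree_ideal_subset_gr_ideal)


section \<open>Initial monomials\<close>

lemma finite_has_greatest:
  assumes "finite A" "A \<noteq> {}" "trans R"
    and total: "\<And>x y. x \<in> A \<Longrightarrow> y \<in> A \<Longrightarrow> (x, y) \<in> R \<or> (y, x) \<in> R"
  obtains x where "x \<in> A" "\<And>y. y \<in> A \<Longrightarrow> (y, x) \<in> R"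
proof -
  have "\<exists>x\<in>A. \<forall>y\<in>A. (y, x) \<in> R"
    using assms(1,2) total
  proof (induction rule: finite_ne_induct)
    case (singleton x)
    then show ?case by auto
  next
    case (insert z A)
    then obtain x where x: "x \<in> A" "\<And>y. y \<in> A \<Longrightarrow> (y, x) \<in> R" by auto
    show ?case
    proof (cases "(z, x) \<in> R")
      case True
      then show ?thesis using x by blast
    next
      case False
      then have "(x, z) \<in> R" "(z, z) \<in> R" using insert.prems[of x z] insert.prems[of z z] x(1) by auto
      then have "\<forall>y\<in>insert z A. (y, z) \<in> R"
        using x(2) transD[OF assms(3)] by blast
      then show ?thesis by blast
    qed
  qed
  then show thesis using that by blast
qed

context
  fixes n :: nat and r :: "expo rel"
  assumes order: "monomial_order n r"
begin

lemma order_refl: "t \<in> monomials n \<Longrightarrow> (t, t) \<in> r"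
  using order by (auto simp: monomial_order_def order_on_defs refl_on_def)

lemma order_antisym: "(t, u) \<in> r \<Longrightarrow> (u, t) \<in> r \<Longrightarrow> t = u"
  using order by (auto simp: monomial_order_def order_on_defs dest: antisymD)

lemma order_trans: "(t, u) \<in> r \<Longrightarrow> (u, v) \<in> r \<Longrightarrow> (t, v) \<in> r"
  using order by (auto simp: monomial_order_def order_on_defs dest: transD)

lemma order_linear: "t \<in> monomials n \<Longrightarrow> u \<in> monomials n \<Longrightarrow> (t, u) \<in> r \<or> (u, t) \<in> r"
  using order order_refl by (cases "t = u") (auto simp: monomial_order_def order_on_defs total_on_def)

lemma order_add_left:
  assumes "(t, u) \<in> r" "v \<in> monomials n"
  shows "(v + t, v + u) \<in> r"
proof -
  have "t \<in> monomials n" "u \<in> monomials n"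
    using assms(1) order by (auto simp: monomial_order_def order_on_defs)
  then show ?thesis
    using assms order order_refl[of "v + t"] by (cases "t = u") (auto simp: monomial_order_def)
qed

lemma order_sum:
  assumes "\<And>a. a \<in> A \<Longrightarrow> (f a, g a) \<in> r"
  shows "(sum f A, sum g A) \<in> r"
  using assms
proof (induction A rule: infinite_finite_induct)
  case (insert a A)
  have mon: "f b \<in> monomials n" "g b \<in> monomials n" if "b \<in> insert a A" for b
    using insert.prems[OF that] order by (auto simp: monomial_order_def order_on_defs)
  have "(f a + sum f A, f a + sum g A) \<in> r"
    using insert mon by (intro order_add_left) auto
  moreover have "(sum g A + f a, sum g A + g a) \<in> r"
    using insert mon by (intro order_add_left sum_in_monomials) auto
  ultimately have "(f a + sum f A, g a + sum g A) \<in> r"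
    by (metis order_trans add.commute)
  then show ?case using insert.hyps by simp
qed (auto intro: order_refl)

lemma initial_monomial_eqI:
  assumes "t \<in> Poly_Mapping.keys f" "\<And>s. s \<in> Poly_Mapping.keys f \<Longrightarrow> (s, t) \<in> r"
  shows "initial_monomial r f = t"
  unfolding initial_monomial_def
  by (rule the_equality) (use assms order_antisym in blast)+

lemma initial_monomial_max:
  assumes "Poly_Mapping.keys f \<subseteq> monomials n" "f \<noteq> 0"
  shows "initial_monomial r f \<in> Poly_Mapping.keys f"
    and "s \<in> Poly_Mapping.keys f \<Longrightarrow> (s, initial_monomial r f) \<in> r"
proof -
  obtain t where t: "t \<in> Poly_Mapping.keys f" "\<And>s. s \<in> Poly_Mapping.keys f \<Longrightarrow> (s, t) \<in> r"
  proof (rule finite_has_greatest[of "Poly_Mapping.keys f" r])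
    show "trans r" using order_trans by (rule transI)
    show "(s, t) \<in> r \<or> (t, s) \<in> r"
      if "s \<in> Poly_Mapping.keys f" "t \<in> Poly_Mapping.keys f" for s t
      using that assms(1) by (intro order_linear) auto
  qed (use assms(2) in auto)
  then have "initial_monomial r f = t" by (rule initial_monomial_eqI)
  then show "initial_monomial r f \<in> Poly_Mapping.keys f"
    "s \<in> Poly_Mapping.keys f \<Longrightarrow> (s, initial_monomial r f) \<in> r"
    using t by auto
qed

lemma initial_monomial_Monomial_mult:
  assumes "Poly_Mapping.keys f \<subseteq> monomials n" "f \<noteq> 0" "u \<in> monomials n"
  shows "initial_monomial r (Monomial u * f) = u + initial_monomial r f"
  by (rule initial_monomial_eqI)
     (use initial_monomial_max[OF assms(1,2)] assms(3) order_add_left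
      in \<open>auto simp: keys_Monomial_mult\<close>)

text \<open>The initial monomials of the elements of an ideal are closed under multiplication by
  monomials, so the initial ideal contains no further monomials.\<close>

lemma Monomial_in_initial_ideal_iff:
  assumes I: "ideal I (poly_ring n)" and t: "t \<in> monomials n"
  shows "Monomial t \<in> initial_ideal n r I \<longleftrightarrow> (\<exists>f\<in>I. f \<noteq> 0 \<and> initial_monomial r f = t)"
proof -
  let ?G = "{Monomial (initial_monomial r f) |f. f \<in> I \<and> f \<noteq> 0}"
  define L where "L = {initial_monomial r f |f. f \<in> I \<and> f \<noteq> 0}"
  have L: "L \<subseteq> monomials n"
    using initial_monomial_max(1) poly_ideal_subset[OF I] by (fastforce simp: L_def)
  have closed: "u + s \<in> L" if s: "s \<in> L" and u: "u \<in> monomials n" for u s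
  proof -
    obtain f where f: "f \<in> I" "f \<noteq> 0" "s = initial_monomial r f" using s by (auto simp: L_def)
    have "Monomial u * f \<in> I" using f u by (intro poly_ideal_mult[OF I]) auto
    moreover have "Monomial u * f \<noteq> 0"
      using f(2) keys_Monomial_mult[of u f] by (metis image_is_empty keys_eq_empty)
    moreover have "initial_monomial r (Monomial u * f) = u + s"
      using f u poly_ideal_subset[OF I] by (simp add: initial_monomial_Monomial_mult)
    ultimately show ?thesis unfolding L_def by force
  qed
  have G: "?G \<subseteq> carrier (poly_ring n)" using L by (auto simp: L_def)
  have "ideal {f. Poly_Mapping.keys f \<subseteq> L} (poly_ring n)"
  proof (rule poly_idealI)
    fix f g :: mpoly assume "f \<in> {f. Poly_Mapping.keys f \<subseteq> L}" "g \<in> {f. Poly_Mapping.keys f \<subseteq> L}"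
    then show "f + g \<in> {f. Poly_Mapping.keys f \<subseteq> L}" using Poly_Mapping.keys_add[of f g] by auto
  next
    fix f :: mpoly and u c assume "f \<in> {f. Poly_Mapping.keys f \<subseteq> L}" "u \<in> monomials n"
    then have "Poly_Mapping.keys (Poly_Mapping.single u c * f) \<subseteq> L"
      using closed by (intro keys_mult_subset) (auto split: if_splits)
    then show "Poly_Mapping.single u c * f \<in> {f. Poly_Mapping.keys f \<subseteq> L}" by simp
  qed (use L in auto)
  then have "initial_ideal n r I \<subseteq> {f. Poly_Mapping.keys f \<subseteq> L}"
    unfolding initial_ideal_def
    by (rule ring.genideal_minimal[OF poly_ring_is_ring]) (auto simp: L_def)
  moreover have "?G \<subseteq> initial_ideal n r I"
    unfolding initial_ideal_def by (rule ring.genideal_self[OF poly_ring_is_ring G])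
  ultimately show ?thesis by (fastforce simp: L_def)
qed

section \<open>Minimal spanning trees and standard monomials\<close>

text \<open>Distinct trees have distinct monomials, so antisymmetry of the order makes the minimal tree
  unique.\<close>

lemma min_tree:
  assumes "B \<noteq> {}" "B \<subseteq> {1..n}"
  shows "is_tree B (min_tree r B)"
    and "is_tree B E \<Longrightarrow> (graph_monomial (min_tree r B), graph_monomial E) \<in> r"
proof -
  let ?T = "{E. is_tree B E}"
  have fin: "finite B" using assms(2) by (rule finite_subset) simp
  have "?T \<subseteq> Pow (Pow B)" by (auto simp: is_tree_def)
  then have finT: "finite ?T" using fin by (auto intro: finite_subset)
  obtain b where "b \<in> B" using assms(1) by blast
  then have neT: "?T \<noteq> {}" using is_tree_star[OF fin] by blast
  have finE: "finite E" if "is_tree B E" for E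
    using that graph_on_finite by (auto simp: is_tree_iff)
  have mon: "graph_monomial ` ?T \<subseteq> monomials n"
    using assms(2) by (auto simp: is_tree_def pairs_def intro!: graph_monomial_in_monomials)
  obtain t where "t \<in> graph_monomial ` ?T" "\<And>s. s \<in> graph_monomial ` ?T \<Longrightarrow> (s, t) \<in> converse r"
  proof (rule finite_has_greatest[of "graph_monomial ` ?T" "converse r"])
    show "trans (converse r)" using order_trans by (auto intro: transI)
    show "(s, t) \<in> converse r \<or> (t, s) \<in> converse r"
      if "s \<in> graph_monomial ` ?T" "t \<in> graph_monomial ` ?T" for s t
      using that mon order_linear[of t s] by auto
  qed (use finT neT in auto)
  then obtain E0 where E0: "is_tree B E0"
    "\<And>E. is_tree B E \<Longrightarrow> (graph_monomial E0, graph_monomial E) \<in> r"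
    by auto
  have "min_tree r B = E0"
    unfolding min_tree_def
  proof (rule the_equality)
    show "is_tree B E0 \<and> (\<forall>E'. is_tree B E' \<longrightarrow> (graph_monomial E0, graph_monomial E') \<in> r)"
      using E0 by blast
    fix E assume E: "is_tree B E \<and>
      (\<forall>E'. is_tree B E' \<longrightarrow> (graph_monomial E, graph_monomial E') \<in> r)"
    then have "graph_monomial E = graph_monomial E0" using E0 by (intro order_antisym) auto
    then show "E = E0" using keys_graph_monomial finE E E0(1) by metis
  qed
  then show "is_tree B (min_tree r B)"
    "is_tree B E \<Longrightarrow> (graph_monomial (min_tree r B), graph_monomial E) \<in> r"
    using E0 by auto
qed

lemma partition_monomial:
  assumes "\<pi> \<in> partitions n m"
  shows "partition_monomial r \<pi> \<in> monomials n" "components n (partition_monomial r \<pi>) = \<pi>"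
    "expo_deg (partition_monomial r \<pi>) + card \<pi> = n"
proof -
  have P: "partition_on {1..n} \<pi>" using assms by (simp add: partitions_def)
  have T: "is_tree B (min_tree r B)" if "B \<in> \<pi>" for B
    using that partition_onD1[OF P] partition_onD3[OF P] by (intro min_tree(1)) auto
  show "partition_monomial r \<pi> \<in> monomials n" "components n (partition_monomial r \<pi>) = \<pi>"
    "expo_deg (partition_monomial r \<pi>) + card \<pi> = n"
    unfolding partition_monomial_def using forest_monomial[OF P T] by auto
qed

text \<open>Equality in the bound on the degree makes the monomial square-free and its graph acyclic; as
  paths do not leave a component, the restriction to a component stays connected and is a tree.\<close>

lemma forest_decomposition:
  assumes "t \<in> monomials n" "expo_deg t + card (components n t) = n"
  defines "F \<equiv> \<lambda>B. {e \<in> Poly_Mapping.keys t. e \<subseteq> B}"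
  shows "B \<in> components n t \<Longrightarrow> is_tree B (F B)"
    and "t = (\<Sum>B\<in>components n t. graph_monomial (F B))"
proof -
  let ?E = "Poly_Mapping.keys t"
  have g: "graph_on {1..n} ?E" using assms(1) by (simp add: graph_on_iff_pairs monomials_def)
  have P: "partition_on {1..n} (components n t)" by (rule partition_on_components[OF assms(1)])
  have "n \<le> card (components n t) + card ?E"
    using card_le_comps_plus_edges[OF _ g] by (simp add: components_def)
  then have card: "expo_deg t = card ?E" "n = card (components n t) + card ?E"
    using assms(2) expo_deg_ge_card_keys[of t] by auto
  have acyclic: "\<not> has_cycle ?E"
    using acyclic_iff_card[OF _ g] card(2) by (simp add: components_def)
  show "is_tree B (F B)" if B: "B \<in> components n t" for B
    unfolding is_tree_iff
  proof (intro conjI)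
    have sub: "B \<subseteq> {1..n}" "B \<noteq> {}" using B partition_onD1[OF P] partition_onD3[OF P] by auto
    show "finite B" using sub(1) by (rule finite_subset) simp
    show "B \<noteq> {}" by (rule sub)
    show "graph_on B (F B)" using g by (auto simp: F_def graph_on_def)
    show "\<not> has_cycle (F B)" using acyclic has_cycle_mono[of "F B" ?E] by (auto simp: F_def)
    obtain b where b: "b \<in> {1..n}" "B = conn ?E `` {b}"
      using B by (auto simp: components_def comps_def)
    have "(b, x) \<in> conn (F B)" if "(b, x) \<in> conn ?E" for x
      using that unfolding conn_def
    proof induction
      case (step y z)
      have "(b, y) \<in> conn ?E" using step.hyps(1) by (simp add: conn_def)
      moreover have "(y, z) \<in> conn ?E" using step.hyps(2) by (auto intro: conn_edge)
      ultimately have "{y, z} \<subseteq> B" unfolding b(2) by (auto intro: conn_trans)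
      then have "{y, z} \<in> F B" using step.hyps(2) by (simp add: F_def)
      then show ?case using step.IH by (auto intro: rtrancl.rtrancl_into_rtrancl)
    qed simp
    then show "B \<times> B \<subseteq> conn (F B)"
      unfolding b(2) by (auto simp del: conn_refl) (meson conn_sym conn_trans)
  qed
  have "t = graph_monomial ?E" using card(1) by (rule eq_graph_monomial_keys)
  also have "?E = (\<Union>B\<in>components n t. F B)"
    using edge_in_comp[OF g] by (auto simp: F_def components_def)
  also have "graph_monomial \<dots> = (\<Sum>B\<in>components n t. graph_monomial (F B))"
    unfolding graph_monomial_def
  proof (rule sum.UNION_disjoint)
    show "\<forall>B\<in>components n t. \<forall>C\<in>components n t. B \<noteq> C \<longrightarrow> F B \<inter> F C = {}"
    proof (intro ballI impI)
      fix B C assume BC: "B \<in> components n t" "C \<in> components n t" "B \<noteq> C"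
      have "\<not> (e \<subseteq> B \<and> e \<subseteq> C)" if "e \<in> ?E" for e
      proof -
        obtain x y where "e = {x, y}" using graph_on_edge[OF g \<open>e \<in> ?E\<close>] by blast
        then show ?thesis using partition_on_same_block[OF P BC(1,2)] BC(3) by auto
      qed
      then show "F B \<inter> F C = {}" by (auto simp: F_def)
    qed
  qed (auto simp: F_def)
  finally show "t = (\<Sum>B\<in>components n t. graph_monomial (F B))" .
qed

lemma partition_monomial_minimal:
  assumes "t \<in> monomials n" "expo_deg t + card (components n t) = n"
  shows "(partition_monomial r (components n t), t) \<in> r"
proof -
  let ?F = "\<lambda>B. {e \<in> Poly_Mapping.keys t. e \<subseteq> B}"
  have P: "partition_on {1..n} (components n t)" by (rule partition_on_components[OF assms(1)])
  have "(partition_monomial r (components n t),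
      \<Sum>B\<in>components n t. graph_monomial (?F B)) \<in> r"
    unfolding partition_monomial_def
  proof (rule order_sum)
    fix B assume B: "B \<in> components n t"
    then show "(graph_monomial (min_tree r B), graph_monomial (?F B)) \<in> r"
      using partition_onD1[OF P] partition_onD3[OF P]
      by (intro min_tree(2) forest_decomposition(1)[OF assms]) auto
  qed
  then show ?thesis using forest_decomposition(2)[OF assms] by simp
qed

text \<open>A standard monomial does not lie in the tree ideal, so it is a forest; it cannot exceed the
  minimal forest with the same components, because the difference of the two lies in the ideal.
  Conversely, a minimal forest cannot be an initial monomial, because its coefficient would be
  the value of one of the functionals that vanish on the ideal.\<close>

lemma standard_monomials_tree_ideal:
  "standard_monomials n r (tree_ideal n m) = partition_monomial r ` partitions n m"
proof (intro equalityI subsetI)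
  fix t assume "t \<in> standard_monomials n r (tree_ideal n m)"
  then have t: "t \<in> monomials n"
    and std: "\<And>f. f \<in> tree_ideal n m \<Longrightarrow> f \<noteq> 0 \<Longrightarrow> initial_monomial r f \<noteq> t"
    using Monomial_in_initial_ideal_iff[OF tree_ideal_ideal] by (auto simp: standard_monomials_def)
  let ?p = "components n t"
  have "initial_monomial r (Monomial t) = t"
    by (rule initial_monomial_eqI) (use t order_refl in auto)
  then have "Monomial t \<notin> tree_ideal n m" using std[of "Monomial t"] by auto
  then have p: "?p \<in> partitions n m" "expo_deg t + card ?p = n"
    using Monomial_in_tree_ideal[OF t] by auto
  let ?M = "partition_monomial r ?p"
  have "tree_cong n m t ?M"
    using p t partition_monomial[OF p(1)] by (intro tree_cong_same_components) auto
  then have mem: "Monomial t - Monomial ?M \<in> tree_ideal n m" by (simp add: tree_cong_def)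
  have "t = ?M"
  proof (rule ccontr)
    assume ne: "t \<noteq> ?M"
    then have "Poly_Mapping.keys (Monomial t - Monomial ?M) = {t, ?M}"
      by (auto simp: in_keys_iff lookup_minus Monomial_def lookup_single when_def split: if_splits)
    moreover from this have "initial_monomial r (Monomial t - Monomial ?M) = t"
      using partition_monomial_minimal[OF t p(2)] order_refl[OF t]
      by (intro initial_monomial_eqI) auto
    ultimately show False using std[OF mem] by fastforce
  qed
  then show "t \<in> partition_monomial r ` partitions n m" using p(1) by blast
next
  fix t assume "t \<in> partition_monomial r ` partitions n m"
  then obtain \<pi> where \<pi>: "\<pi> \<in> partitions n m" and t: "t = partition_monomial r \<pi>" by blast
  note M = partition_monomial[OF \<pi>, folded t]
  have False if f: "f \<in> tree_ideal n m" "f \<noteq> 0" "initial_monomial r f = t" for f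
  proof -
    have keys: "Poly_Mapping.keys f \<subseteq> monomials n"
      using f(1) poly_ideal_subset[OF tree_ideal_ideal] by blast
    have tf: "t \<in> Poly_Mapping.keys f" and max: "\<And>s. s \<in> Poly_Mapping.keys f \<Longrightarrow> (s, t) \<in> r"
      using initial_monomial_max[OF keys f(2)] f(3) by auto
    \<comment> \<open>Every other monomial that contributes to the coefficient of \<open>\<pi>\<close> exceeds \<open>t\<close>,
      the largest monomial of \<open>f\<close>.\<close>
    have "forest_weight n \<pi> s = (if s = t then 1 else 0)" if s: "s \<in> Poly_Mapping.keys f" for s
    proof (cases "components n s = \<pi> \<and> expo_deg s + card \<pi> = n")
      case True
      then have "(t, s) \<in> r"
        using partition_monomial_minimal[of s] s keys by (auto simp: t)
      then have "s = t" using max[OF s] order_antisym by blast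
      then show ?thesis using True by (simp add: forest_weight_def)
    next
      case False
      then have "s \<noteq> t" using M by auto
      then show ?thesis using False by (auto simp: forest_weight_def)
    qed
    then have "forest_coeff n \<pi> f = weighted_sum (\<lambda>s. if s = t then 1 else 0) f"
      unfolding forest_coeff_def by (rule weighted_sum_cong)
    also have "\<dots> = Poly_Mapping.lookup f t"
      using tf by (simp add: weighted_sum_def if_distrib[of "(*) _"] cong: if_cong)
    finally show False
      using tree_ideal_forest_coeff[OF f(1) \<pi>] tf by (simp add: in_keys_iff)
  qed
  then show "t \<in> standard_monomials n r (tree_ideal n m)"
    using M(1) Monomial_in_initial_ideal_iff[OF tree_ideal_ideal M(1)]
    by (auto simp: standard_monomials_def)
qed

lemma bij_betw_standard_monomials:
  "bij_betw (partition_monomial r) (partitions n m) (standard_monomials n r (tree_ideal n m))"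
  unfolding bij_betw_def standard_monomials_tree_ideal
  using partition_monomial(2) by (metis inj_onI)

lemma bij_betw_standard_monomial_basis:
  "bij_betw (\<lambda>\<pi>. tree_ideal n m +>\<^bsub>poly_ring n\<^esub> Monomial (partition_monomial r \<pi>))
    (partitions n m) (standard_monomial_basis n r (tree_ideal n m))"
  unfolding bij_betw_def
proof
  show "inj_on (\<lambda>\<pi>. tree_ideal n m +>\<^bsub>poly_ring n\<^esub> Monomial (partition_monomial r \<pi>)) (partitions n m)"
  proof (rule inj_onI)
    fix \<pi> \<sigma> assume \<pi>: "\<pi> \<in> partitions n m" and \<sigma>: "\<sigma> \<in> partitions n m"
      and "tree_ideal n m +>\<^bsub>poly_ring n\<^esub> Monomial (partition_monomial r \<pi>) =
        tree_ideal n m +>\<^bsub>poly_ring n\<^esub> Monomial (partition_monomial r \<sigma>)"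
    then have "Monomial (partition_monomial r \<pi>) - Monomial (partition_monomial r \<sigma>) \<in> tree_ideal n m"
      using partition_monomial(1)
      by (subst (asm) poly_ideal_coset_eq_iff[OF tree_ideal_ideal]) auto
    from tree_ideal_forest_coeff[OF this \<pi>] show "\<pi> = \<sigma>"
      using partition_monomial[OF \<pi>] partition_monomial[OF \<sigma>]
      by (auto simp: forest_coeff_def weighted_sum_diff forest_weight_def split: if_splits)
  qed
  show "(\<lambda>\<pi>. tree_ideal n m +>\<^bsub>poly_ring n\<^esub> Monomial (partition_monomial r \<pi>)) ` partitions n m =
      standard_monomial_basis n r (tree_ideal n m)"
    by (simp add: standard_monomial_basis_def standard_monomials_tree_ideal image_image)
qed

end

theorem theorem3p27:
  fixes n m :: nat and r :: "expo rel"
  assumes "m \<le> n"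
    and "monomial_order n r"
  shows "orbit_harmonics_ring n (partition_points n m) = poly_ring n Quot tree_ideal n m \<and>
    bij_betw (partition_monomial r) (partitions n m)
      (standard_monomials n r (tree_ideal n m)) \<and>
    bij_betw (\<lambda>\<pi>. tree_ideal n m +>\<^bsub>poly_ring n\<^esub> Monomial (partition_monomial r \<pi>))
      (partitions n m) (standard_monomial_basis n r (tree_ideal n m)) \<and>
    descends_to_basis n (tree_ideal n m) (partitions n m) (\<lambda>\<pi>. Monomial (partition_monomial r \<pi>))"
proof (intro conjI)
  show "orbit_harmonics_ring n (partition_points n m) = poly_ring n Quot tree_ideal n m"
    by (simp add: orbit_harmonics_ring_def gr_ideal_eq_tree_ideal)
  show "bij_betw (partition_monomial r) (partitions n m) (standard_monomials n r (tree_ideal n m))"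
    using assms(2) by (rule bij_betw_standard_monomials)
  show "bij_betw (\<lambda>\<pi>. tree_ideal n m +>\<^bsub>poly_ring n\<^esub> Monomial (partition_monomial r \<pi>))
      (partitions n m) (standard_monomial_basis n r (tree_ideal n m))"
    using assms(2) by (rule bij_betw_standard_monomial_basis)
  interpret forest_representatives n m "partition_monomial r"
    by unfold_locales (use partition_monomial[OF assms(2)] in auto)
  show "descends_to_basis n (tree_ideal n m) (partitions n m)
      (\<lambda>\<pi>. Monomial (partition_monomial r \<pi>))"
    by (rule descends_to_basis_tree_ideal)
qed

end
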